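(* Let $2<q<p<\infty$. If $\theta\in(0,1)$ is such that the metric space $(L_q,\|x-y\|_q^\theta)$ admits a bi-Lipschitz embedding into $L_p$, then $$\theta\le\frac{2q(p-q)+q^2(p-1)(p-2)}{2p^2(q-2)}\left(\sqrt{1+\frac{4p(p-2)(q-2)}{(pq-3q+2)^2}}-1\right)\le 1-\frac{(p-q)(q-2)}{2p^3}.$$
   Context: $L_r=L_r([0,1])$ with Lebesgue measure. A metric space $(X,d_X)$ admits a bi-Lipschitz embedding into a metric space $(Y,d_Y)$ if there are $s>0$, $D\ge1$ and $f:X\to Y$ with $s\,d_X(x,y)\le d_Y(f(x),f(y))\le Ds\,d_X(x,y)$ for all $x,y\in X$. *)

theory Defs
  imports "HOL-Analysis.Analysis"
begin

text \<open>Real L_p([0,1]) with Lebesgue measure, represented by functions (not quotiented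
  by a.e. equality); the distance is then a pseudometric. A bi-Lipschitz embedding
  of the pseudometric space is equivalent to one of the quotient metric space.\<close>

definition Lp_space :: "real \<Rightarrow> (real \<Rightarrow> real) set" where
  "Lp_space p = {f. f \<in> borel_measurable (lebesgue_on {0..1}) \<and>
                     integrable (lebesgue_on {0..1}) (\<lambda>x. \<bar>f x\<bar> powr p)}"

definition Lp_norm :: "real \<Rightarrow> (real \<Rightarrow> real) \<Rightarrow> real" where
  "Lp_norm p f = (\<integral>x. \<bar>f x\<bar> powr p \<partial>(lebesgue_on {0..1})) powr (1 / p)"

definition Lp_dist :: "real \<Rightarrow> (real \<Rightarrow> real) \<Rightarrow> (real \<Rightarrow> real) \<Rightarrow> real" where
  "Lp_dist p f g = Lp_norm p (\<lambda>x. f x - g x)"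

definition bilip_embeds :: "'a set \<Rightarrow> ('a \<Rightarrow> 'a \<Rightarrow> real) \<Rightarrow> 'b set \<Rightarrow> ('b \<Rightarrow> 'b \<Rightarrow> real) \<Rightarrow> bool" where
  "bilip_embeds X dX Y dY \<longleftrightarrow> (\<exists>s>0. \<exists>D\<ge>1. \<exists>f. (\<forall>x\<in>X. f x \<in> Y) \<and>
     (\<forall>x\<in>X. \<forall>y\<in>X. s * dX x y \<le> dY (f x) (f y) \<and> dY (f x) (f y) \<le> D * s * dX x y))"

end

theory Submission
  imports Defs
begin

text \<open>In fact \<^term>\<open>\<theta> \<le> q / p\<close>, and the middle expression \<open>B\<close> is the positive root of
  \<open>p(q-2)B\<^sup>2 + q(pq-3q+2)B = q\<^sup>2(p-2)\<close>, which is at least \<open>q/p\<close>.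

  Restrict an embedding to a copy of \<open>\<real>\<^sup>n\<close> with the \<open>\<ell>\<^sub>q\<close> norm, \<open>n = k\<tau>\<close>, and mollify it at unit scale
  to a map \<open>G\<close>. Since \<open>\<partial>\<^sub>jG\<close> is the expectation of the map against the score of the \<open>j\<close>-th
  coordinate of the mollifier, and the scores of distinct coordinates are orthogonal, Bessel's inequality
  bounds \<open>\<Sum>\<^sub>j (\<partial>\<^sub>jG)\<^sup>2\<close> pointwise by the mean square oscillation at unit scale. Now let \<open>v\<close> be
  a random sum of \<open>k\<close> signed unit vectors, one from each of \<open>k\<close> blocks of \<open>\<tau>\<close> coordinates. The derivative
  of \<open>G\<close> in direction \<open>v\<close> is a sum of independent symmetric variables, and Rosenthal's
  inequality bounds its \<open>p\<close>-th moment by a multiple of \<open>k + \<tau>\<^bsup>-p/2\<^esup> n\<^bsup>\<gamma>\<^esup>\<close>, \<open>\<gamma> = \<theta>p/q\<close>.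
  Integrating along segments of length \<open>m\<close> in direction \<open>v\<close>, and averaging over the starting point, gives
  \<open>(k m\<^sup>q)\<^bsup>\<gamma>\<^esup> \<le> C (n\<^bsup>\<gamma>\<^esup> + m\<^sup>p (k + \<tau>\<^bsup>-p/2\<^esup> n\<^bsup>\<gamma>\<^esup>))\<close>. If \<open>\<gamma> > 1\<close>, this fails when
  \<open>m\<close> is a large multiple of \<open>\<tau>\<^bsup>1/q\<^esup>\<close>, \<open>\<tau>\<close> is large, and \<open>k\<close> is much larger still.

  Everything is discretised on a grid of mesh \<open>1/N\<close>, so that only finite sums of \<open>L\<^sub>p\<close> functions
  occur; the discretisation errors vanish as \<open>N \<rightarrow> \<infinity>\<close> with \<open>k, \<tau>, m\<close> fixed.\<close>

section \<open>Jensen and Rosenthal inequalities\<close>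

lemma sum_PiE_insert:
  fixes h :: "('i \<Rightarrow> 'a) \<Rightarrow> 'b::comm_monoid_add"
  assumes "j \<notin> I"
  shows "(\<Sum>f\<in>PiE (insert j I) A. h f) = (\<Sum>a\<in>A j. \<Sum>f\<in>PiE I A. h (f(j := a)))"
proof -
  have "(\<Sum>f\<in>PiE (insert j I) A. h f) = (\<Sum>(a, f)\<in>A j \<times> PiE I A. h (f(j := a)))"
    unfolding PiE_insert_eq
    by (subst sum.reindex) (use inj_combinator[OF assms] in \<open>auto simp: case_prod_unfold o_def\<close>)
  then show ?thesis
    by (simp add: sum.cartesian_product)
qed

text \<open>A convex function lies above its tangent. Scaling by \<open>a\<close> moves the point of
  tangency to 1. The point \<open>x = 0\<close> is separate because the derivative of
  \<open>powr\<close> is used only on the positive reals; there the left side is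
  \<open>(1 - p) * a powr p\<close>, which is not positive.\<close>

lemma powr_tangent_le:
  fixes a x p :: real
  assumes "1 \<le> p" "0 < a" "0 \<le> x"
  shows "a powr p + p * a powr (p - 1) * (x - a) \<le> x powr p"
proof (cases "x = 0")
  case True
  have "a powr p = a powr (p - 1) * a"
    using powr_mult_base[of a "p - 1"] assms by (simp add: mult.commute)
  then show ?thesis using True assms by (simp add: mult_le_cancel_right1)
next
  case False
  define t where "t = x / a"
  have t: "t > 0" "x = a * t" using False assms by (auto simp: t_def)
  have "1 + p * (t - 1) \<le> t powr p"
  proof -
    have "((\<lambda>x. x powr p) has_real_derivative p * s powr (p - 1)) (at s within {0<..})" if "s > 0" for s
      using that by (rule has_field_derivative_at_within[OF has_real_derivative_powr])
    from this[of 1] have "t powr p - 1 powr p \<ge> (p * 1 powr (p - 1)) * (t - 1)"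
      using t by (intro convex_on_imp_above_tangent[OF powr_convex[OF assms(1)]]) (auto simp: interior_open connected_Ioi)
    then show ?thesis by simp
  qed
  then have "a powr p * (1 + p * (t - 1)) \<le> a powr p * t powr p"
    by (intro mult_left_mono) auto
  moreover have "a powr p = a powr (p - 1) * a"
    using powr_mult_base[of a "p - 1"] assms by (simp add: mult.commute)
  ultimately show ?thesis
    using assms t by (simp add: powr_mult algebra_simps)
qed

text \<open>Weighted Jensen for weights that need not sum to 1, whence the power of the total
  weight. Summing the tangent inequality at the weighted mean \<open>a = H / W\<close> makes the
  linear terms cancel; vanishing \<open>H\<close> is handled first so that
  \<open>a > 0\<close>.\<close>

lemma sum_powr_le:
  fixes w h :: "'a \<Rightarrow> real"
  assumes "1 \<le> p" "finite A" "\<And>i. i \<in> A \<Longrightarrow> 0 \<le> w i" "\<And>i. i \<in> A \<Longrightarrow> 0 \<le> h i"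
  shows "(\<Sum>i\<in>A. w i * h i) powr p \<le> (\<Sum>i\<in>A. w i) powr (p - 1) * (\<Sum>i\<in>A. w i * h i powr p)"
proof -
  define W where "W = (\<Sum>i\<in>A. w i)"
  define H where "H = (\<Sum>i\<in>A. w i * h i)"
  have nn: "0 \<le> W" "0 \<le> H" "0 \<le> (\<Sum>i\<in>A. w i * h i powr p)"
    unfolding W_def H_def using assms by (auto intro!: sum_nonneg)
  show ?thesis
  proof (cases "H = 0")
    case True
    then show ?thesis using nn by (simp add: H_def)
  next
    case False
    then have "H > 0" using nn by simp
    have "W > 0"
    proof (rule ccontr)
      assume "\<not> W > 0"
      then have "\<forall>i\<in>A. w i = 0"
        using nn sum_nonneg_eq_0_iff[of A w] assms by (auto simp: W_def)
      then show False using \<open>H > 0\<close> by (simp add: H_def)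
    qed
    define a where "a = H / W"
    have a: "a > 0" "H = W * a" using \<open>H > 0\<close> \<open>W > 0\<close> by (auto simp: a_def)
    have "W * a powr p = (\<Sum>i\<in>A. w i * (a powr p + p * a powr (p - 1) * (h i - a)))"
    proof -
      have "(\<Sum>i\<in>A. w i * (a powr p + p * a powr (p - 1) * (h i - a)))
          = a powr p * W + p * a powr (p - 1) * (H - a * W)"
      proof -
        define d where "d = p * a powr (p - 1)"
        have "(\<Sum>i\<in>A. w i * (a powr p + d * (h i - a))) = (\<Sum>i\<in>A. (a powr p - d * a) * w i + d * (w i * h i))"
          by (intro sum.cong) (auto simp: algebra_simps)
        also have "\<dots> = (a powr p - d * a) * W + d * H"
          by (simp add: sum.distrib sum_distrib_left W_def H_def)
        finally show ?thesis by (simp add: d_def algebra_simps)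
      qed
      also have "H - a * W = 0" using a(2) by simp
      finally show ?thesis by (simp add: mult.commute)
    qed
    also have "\<dots> \<le> (\<Sum>i\<in>A. w i * h i powr p)"
      using assms a by (intro sum_mono mult_left_mono powr_tangent_le) auto
    finally have "W powr (p - 1) * (W * a powr p) \<le> W powr (p - 1) * (\<Sum>i\<in>A. w i * h i powr p)"
      by (rule mult_left_mono) auto
    moreover have "W powr (p - 1) * (W * a powr p) = H powr p"
    proof -
      have "W powr (p - 1) * W = W powr p"
        using powr_mult_base[of W "p - 1"] \<open>W > 0\<close> by (simp add: mult.commute)
      then show ?thesis using a \<open>W > 0\<close> by (simp add: powr_mult mult.assoc[symmetric])
    qed
    ultimately show ?thesis by (simp add: W_def H_def)
  qed
qed

lemma abs_sum_powr_le:
  fixes w h :: "'a \<Rightarrow> real"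
  assumes "1 \<le> p" "finite A"
  shows "\<bar>\<Sum>i\<in>A. w i * h i\<bar> powr p \<le> (\<Sum>i\<in>A. \<bar>w i\<bar>) powr (p - 1) * (\<Sum>i\<in>A. \<bar>w i\<bar> * \<bar>h i\<bar> powr p)"
proof -
  have "\<bar>\<Sum>i\<in>A. w i * h i\<bar> powr p \<le> (\<Sum>i\<in>A. \<bar>w i\<bar> * \<bar>h i\<bar>) powr p"
    using assms(1) sum_abs[of "\<lambda>i. w i * h i" A] by (intro powr_mono2) (auto simp: abs_mult)
  also have "\<dots> \<le> (\<Sum>i\<in>A. \<bar>w i\<bar>) powr (p - 1) * (\<Sum>i\<in>A. \<bar>w i\<bar> * \<bar>h i\<bar> powr p)"
    by (rule sum_powr_le) (use assms in auto)
  finally show ?thesis .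
qed

section \<open>Moments of sums of independent symmetric variables\<close>

lemma exp_sum_minus_le: "exp z + exp (- z) \<le> 2 + z\<^sup>2 * exp \<bar>z\<bar>" for z :: real
proof -
  have *: "exp z + exp (- z) \<le> 2 + z\<^sup>2 * exp z" if "z \<ge> 0" for z :: real
  proof -
    \<comment> \<open>The left side of the claim exceeds 2 by the square of this difference, which
      is at most \<open>z * exp (z/2)\<close>.\<close>
    have "exp (z/2) - exp (-z/2) = exp (z/2) * (1 - exp (-z))"
      by (simp add: algebra_simps exp_add[symmetric])
    also have "\<dots> \<le> exp (z/2) * z"
      using exp_ge_add_one_self[of "-z"] by (intro mult_left_mono) (auto simp: algebra_simps)
    finally have "exp (z/2) - exp (-z/2) \<le> exp (z/2) * z" .
    then have "(exp (z/2) - exp (-z/2))\<^sup>2 \<le> (exp (z/2) * z)\<^sup>2"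
      using that by (intro power_mono) auto
    moreover have "(exp (z/2) - exp (-z/2))\<^sup>2 = exp z + exp (-z) - 2"
      by (simp add: power2_eq_square algebra_simps exp_add[symmetric])
    moreover have "(exp (z/2) * z)\<^sup>2 = z\<^sup>2 * exp z"
      by (simp add: power2_eq_square algebra_simps exp_add[symmetric])
    ultimately show ?thesis by simp
  qed
  show ?thesis using *[of z] *[of "-z"] by (cases "z \<ge> 0") (auto simp: add.commute)
qed

text \<open>The two summands serve two regimes: the first the Taylor-type bound for small
  \<open>y / x\<close>, the second the crude bound when \<open>y\<close> dominates.\<close>

definition rosenthal_const :: "real \<Rightarrow> real" where
  "rosenthal_const p = p\<^sup>2 * exp p + 2 * 2 powr p"

lemma rosenthal_const_pos: "rosenthal_const p > 0"
  unfolding rosenthal_const_def by (intro add_nonneg_pos) auto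

text \<open>Averaging over the sign of \<open>y\<close> removes the first-order term in
  \<open>y\<close>. If \<open>y\<close> is at most \<open>x\<close> in size, what is left is
  quadratic in \<open>y / x\<close>; otherwise each power on the left is at most that of
  \<open>2 * \<bar>y\<bar>\<close>.\<close>

lemma powr_symmetrized_le:
  fixes x y p :: real
  assumes "2 \<le> p"
  shows "\<bar>x + y\<bar> powr p + \<bar>x - y\<bar> powr p
      \<le> 2 * \<bar>x\<bar> powr p + rosenthal_const p * (\<bar>x\<bar> powr (p - 2) * y\<^sup>2 + \<bar>y\<bar> powr p)"
proof (cases "\<bar>y\<bar> \<le> \<bar>x\<bar> \<and> x \<noteq> 0")
  case True
  define t where "t = y / x"
  have t: "\<bar>t\<bar> \<le> 1" "y = x * t" using True by (auto simp: t_def field_simps)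
  \<comment> \<open>Passing to exponentials turns the two powers into
    \<open>exp z + exp (- z)\<close> with \<open>z = p * t\<close>, where the linear terms
    cancel.\<close>
  have 1: "(1 + s) powr p \<le> exp (p * s)" if "\<bar>s\<bar> \<le> 1" for s :: real
  proof -
    have "(1 + s) powr p \<le> exp s powr p"
      using that assms exp_ge_add_one_self[of s] by (intro powr_mono2) auto
    then show ?thesis by (simp add: powr_def mult.commute)
  qed
  have "(1 + t) powr p + (1 - t) powr p \<le> exp (p * t) + exp (- (p * t))"
    using 1[of t] 1[of "-t"] t by simp
  also have "\<dots> \<le> 2 + (p * t)\<^sup>2 * exp \<bar>p * t\<bar>" by (rule exp_sum_minus_le)
  also have "\<dots> \<le> 2 + (p * t)\<^sup>2 * exp p"
    using t assms by (intro add_left_mono mult_left_mono) (auto simp: abs_mult mult_le_cancel_left1)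
  finally have "\<bar>x\<bar> powr p * ((1 + t) powr p + (1 - t) powr p) \<le> \<bar>x\<bar> powr p * (2 + (p * t)\<^sup>2 * exp p)"
    by (rule mult_left_mono) auto
  moreover have "\<bar>x + y\<bar> powr p = \<bar>x\<bar> powr p * (1 + t) powr p"
  proof -
    have "\<bar>x + y\<bar> = \<bar>x * (1 + t)\<bar>" by (simp add: t(2) algebra_simps)
    also have "\<dots> = \<bar>x\<bar> * (1 + t)" using t by (simp add: abs_mult)
    finally show ?thesis using t by (simp add: powr_mult)
  qed
  moreover have "\<bar>x - y\<bar> powr p = \<bar>x\<bar> powr p * (1 - t) powr p"
  proof -
    have "\<bar>x - y\<bar> = \<bar>x * (1 - t)\<bar>" by (simp add: t(2) algebra_simps)
    also have "\<dots> = \<bar>x\<bar> * (1 - t)" using t by (simp add: abs_mult)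
    finally show ?thesis using t by (simp add: powr_mult)
  qed
  moreover have "\<bar>x\<bar> powr p * (p * t)\<^sup>2 = p\<^sup>2 * (\<bar>x\<bar> powr (p - 2) * y\<^sup>2)"
  proof -
    have "\<bar>x\<bar> powr p = \<bar>x\<bar> powr (p - 2) * x\<^sup>2"
      using True powr_add[of "\<bar>x\<bar>" "p - 2" 2] by simp
    then show ?thesis by (simp add: t(2) power_mult_distrib)
  qed
  ultimately have "\<bar>x + y\<bar> powr p + \<bar>x - y\<bar> powr p
      \<le> 2 * \<bar>x\<bar> powr p + p\<^sup>2 * (\<bar>x\<bar> powr (p - 2) * y\<^sup>2) * exp p"
    by (simp only: distrib_left mult.assoc[symmetric] mult.commute[of _ 2])
  also have "p\<^sup>2 * (\<bar>x\<bar> powr (p - 2) * y\<^sup>2) * exp p = p\<^sup>2 * exp p * (\<bar>x\<bar> powr (p - 2) * y\<^sup>2)"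
    by simp
  also have "\<dots> \<le> rosenthal_const p * (\<bar>x\<bar> powr (p - 2) * y\<^sup>2 + \<bar>y\<bar> powr p)"
    unfolding rosenthal_const_def by (intro mult_mono) auto
  finally show ?thesis by simp
next
  case False
  then have xy: "\<bar>x\<bar> \<le> \<bar>y\<bar>" by auto
  have 1: "\<bar>x + s * y\<bar> powr p \<le> 2 powr p * \<bar>y\<bar> powr p" if "\<bar>s\<bar> = 1" for s
  proof -
    have "\<bar>x + s * y\<bar> \<le> 2 * \<bar>y\<bar>" using xy that by (auto simp: abs_if split: if_splits)
    then have "\<bar>x + s * y\<bar> powr p \<le> (2 * \<bar>y\<bar>) powr p" using assms by (intro powr_mono2) auto
    then show ?thesis by (simp add: powr_mult)
  qed
  have "\<bar>x + y\<bar> powr p + \<bar>x - y\<bar> powr p \<le> 2 * 2 powr p * \<bar>y\<bar> powr p"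
    using 1[of 1] 1[of "-1"] by simp
  also have "\<dots> \<le> rosenthal_const p * (\<bar>x\<bar> powr (p - 2) * y\<^sup>2 + \<bar>y\<bar> powr p)"
    unfolding rosenthal_const_def by (intro mult_mono) auto
  finally show ?thesis by (simp add: add_increasing)
qed

text \<open>Induction on \<open>k\<close> with \<open>\<bar>x\<bar> powr (p - 2) \<le> \<bar>x\<bar> powr p / V + V powr (p / 2 - 1)\<close>
  makes the \<open>p\<close>-th moments satisfy a discrete Gronwall inequality; hence the factor \<open>exp\<close>. It is
  harmless once \<open>V\<close> is the total variance.\<close>

lemma rosenthal_aux:
  fixes Y :: "nat \<Rightarrow> 'a \<Rightarrow> real"
  assumes p: "2 \<le> p" and A: "finite A" "A \<noteq> {}"
    and sym: "bij_betw \<nu> A A" "\<And>b a. a \<in> A \<Longrightarrow> Y b (\<nu> a) = - Y b a" and V: "V > 0"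
  shows "(\<Sum>\<alpha>\<in>PiE {..<k} (\<lambda>_. A). \<bar>\<Sum>b<k. Y b (\<alpha> b)\<bar> powr p) / card A ^ k
    \<le> exp (rosenthal_const p * (\<Sum>b<k. (\<Sum>a\<in>A. (Y b a)\<^sup>2) / card A) / V) * rosenthal_const p
       * (V powr (p / 2 - 1) * (\<Sum>b<k. (\<Sum>a\<in>A. (Y b a)\<^sup>2) / card A)
          + (\<Sum>b<k. (\<Sum>a\<in>A. \<bar>Y b a\<bar> powr p) / card A))"
proof (induction k)
  case 0
  then show ?case using p by simp
next
  case (Suc k)
  define K where "K = rosenthal_const p"
  have K: "K > 0" unfolding K_def by (rule rosenthal_const_pos)
  define c where "c = real (card A)"
  have c: "c > 0" using A by (simp add: c_def card_gt_0_iff)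
  define v where "v = (\<lambda>b. (\<Sum>a\<in>A. (Y b a)\<^sup>2) / c)"
  define w where "w = (\<lambda>b. (\<Sum>a\<in>A. \<bar>Y b a\<bar> powr p) / c)"
  have vw: "v b \<ge> 0" "w b \<ge> 0" for b using c by (auto simp: v_def w_def intro!: sum_nonneg divide_nonneg_nonneg)
  define X where "X = (\<lambda>\<alpha>. \<Sum>b<k. Y b (\<alpha> b))"
  define P where "P = PiE {..<k} (\<lambda>_. A)"
  have P: "finite P" "real (card P) = c ^ k" using A by (auto simp: P_def c_def card_PiE finite_PiE)
  define M where "M = (\<Sum>\<alpha>\<in>P. \<bar>X \<alpha>\<bar> powr p) / c ^ k"
  have step: "(\<Sum>a\<in>A. \<bar>x + Y k a\<bar> powr p)
      \<le> c * ((1 + K * v k / V) * \<bar>x\<bar> powr p + K * (V powr (p / 2 - 1) * v k + w k))" for x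
  proof -
    \<comment> \<open>The involution-like symmetry \<open>\<nu>\<close> flips the sign of the new
      variable, so its sum can be replaced by the symmetrised one.\<close>
    have "(\<Sum>a\<in>A. \<bar>x + Y k a\<bar> powr p) = (\<Sum>a\<in>A. \<bar>x - Y k a\<bar> powr p)"
      by (subst sum.reindex_bij_betw[OF sym(1), symmetric]) (simp add: sym(2))
    then have "2 * (\<Sum>a\<in>A. \<bar>x + Y k a\<bar> powr p) = (\<Sum>a\<in>A. \<bar>x + Y k a\<bar> powr p + \<bar>x - Y k a\<bar> powr p)"
      by (simp add: sum.distrib)
    also have "\<dots> \<le> (\<Sum>a\<in>A. 2 * \<bar>x\<bar> powr p + K * (\<bar>x\<bar> powr (p - 2) * (Y k a)\<^sup>2 + \<bar>Y k a\<bar> powr p))"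
      unfolding K_def by (intro sum_mono powr_symmetrized_le p)
    also have "\<dots> = c * (2 * \<bar>x\<bar> powr p + K * (\<bar>x\<bar> powr (p - 2) * v k + w k))"
    proof -
      have "(\<Sum>a\<in>A. (Y k a)\<^sup>2) = c * v k" "(\<Sum>a\<in>A. \<bar>Y k a\<bar> powr p) = c * w k"
        using c by (auto simp: v_def w_def)
      then show ?thesis
        by (simp add: sum.distrib sum_distrib_left[symmetric] c_def[symmetric] distrib_left)
    qed
    also have "\<dots> \<le> c * (2 * \<bar>x\<bar> powr p + K * ((\<bar>x\<bar> powr p / V + V powr (p / 2 - 1)) * v k + w k))"
    proof -
      have "\<bar>x\<bar> powr (p - 2) \<le> \<bar>x\<bar> powr p / V + V powr (p / 2 - 1)"
      \<comment> \<open>Above the variance scale the factor \<open>x^2 / V\<close> is at least 1 and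
        gives the first term; below it monotonicity of the power gives the second.\<close>
      proof (cases "x\<^sup>2 \<ge> V")
        case True
        then have "x \<noteq> 0" using V by auto
        then have "\<bar>x\<bar> powr p = \<bar>x\<bar> powr (p - 2) * x\<^sup>2"
          using powr_add[of "\<bar>x\<bar>" "p - 2" 2] by simp
        then have "\<bar>x\<bar> powr (p - 2) * V \<le> \<bar>x\<bar> powr p"
          using True by (simp add: mult_left_mono)
        then show ?thesis using V by (simp add: field_simps add_increasing2)
      next
        case False
        have "\<bar>x\<bar> powr (p - 2) = (x\<^sup>2) powr (p / 2 - 1)"
        proof (cases "x = 0")
          case False
          then have "(x\<^sup>2) = \<bar>x\<bar> powr 2" by simp
          then show ?thesis by (simp add: powr_powr right_diff_distrib del: powr_numeral)
        qed (use p in simp)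
        also have "\<dots> \<le> V powr (p / 2 - 1)" using False p by (intro powr_mono2) auto
        finally show ?thesis using V by (simp add: add_increasing)
      qed
      then show ?thesis using c K vw[of k] by (intro mult_left_mono add_left_mono add_right_mono mult_right_mono) auto
    qed
    \<comment> \<open>Doubling the error term lets the factor 2 from the symmetrisation
      cancel.\<close>
    also have "\<dots> \<le> c * (2 * \<bar>x\<bar> powr p + 2 * (K * ((\<bar>x\<bar> powr p / V + V powr (p / 2 - 1)) * v k + w k)))"
      using c K vw[of k] V by (intro mult_left_mono add_left_mono) (auto intro!: mult_nonneg_nonneg add_nonneg_nonneg)
    also have "\<dots> = 2 * (c * ((1 + K * v k / V) * \<bar>x\<bar> powr p + K * (V powr (p / 2 - 1) * v k + w k)))"
      by (simp add: algebra_simps add_divide_distrib)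
    finally show ?thesis by simp
  qed
  have "(\<Sum>\<alpha>\<in>PiE {..<Suc k} (\<lambda>_. A). \<bar>\<Sum>b<Suc k. Y b (\<alpha> b)\<bar> powr p)
      = (\<Sum>a\<in>A. \<Sum>\<alpha>\<in>P. \<bar>X \<alpha> + Y k a\<bar> powr p)"
    unfolding lessThan_Suc P_def
    by (subst sum_PiE_insert) (auto simp: X_def add.commute intro!: sum.cong)
  also have "\<dots> = (\<Sum>\<alpha>\<in>P. \<Sum>a\<in>A. \<bar>X \<alpha> + Y k a\<bar> powr p)" by (rule sum.swap)
  also have "\<dots> \<le> (\<Sum>\<alpha>\<in>P. c * ((1 + K * v k / V) * \<bar>X \<alpha>\<bar> powr p + K * (V powr (p / 2 - 1) * v k + w k)))"
    by (intro sum_mono step)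
  also have "\<dots> = c ^ Suc k * ((1 + K * v k / V) * M + K * (V powr (p / 2 - 1) * v k + w k))"
  proof -
    have M: "(\<Sum>\<alpha>\<in>P. \<bar>X \<alpha>\<bar> powr p) = c ^ k * M" using c by (simp add: M_def)
    have "(\<Sum>\<alpha>\<in>P. c * (d * \<bar>X \<alpha>\<bar> powr p + e)) = c ^ Suc k * (d * M + e)" for d e
      using P by (simp add: sum.distrib sum_distrib_left[symmetric] M algebra_simps)
    then show ?thesis .
  qed
  finally have "(\<Sum>\<alpha>\<in>PiE {..<Suc k} (\<lambda>_. A). \<bar>\<Sum>b<Suc k. Y b (\<alpha> b)\<bar> powr p) / c ^ Suc k
      \<le> (1 + K * v k / V) * M + K * (V powr (p / 2 - 1) * v k + w k)"
    using c by (simp add: pos_divide_le_eq mult.commute)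
  \<comment> \<open>The Gronwall step: the growth factor is absorbed by
    \<open>1 + u \<le> exp u\<close>, and the new contribution is multiplied by an exponential that
    is at least 1, so that both parts carry the same factor.\<close>
  also have "\<dots> \<le> exp (K * v k / V) * (exp (K * (\<Sum>b<k. v b) / V) * K * (V powr (p / 2 - 1) * (\<Sum>b<k. v b) + (\<Sum>b<k. w b)))
      + exp (K * (\<Sum>b<Suc k. v b) / V) * (K * (V powr (p / 2 - 1) * v k + w k))"
  proof (rule add_mono[OF mult_mono])
    show "1 + K * v k / V \<le> exp (K * v k / V)" by (rule exp_ge_add_one_self)
    show "M \<le> exp (K * (\<Sum>b<k. v b) / V) * K * (V powr (p / 2 - 1) * (\<Sum>b<k. v b) + (\<Sum>b<k. w b))"
      using Suc.IH by (simp add: M_def P_def X_def K_def v_def w_def c_def)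
    show "0 \<le> M" using c by (auto simp: M_def intro!: sum_nonneg divide_nonneg_nonneg)
    have "1 \<le> exp (K * (\<Sum>b<Suc k. v b) / V)"
      using K V vw by (auto intro!: divide_nonneg_nonneg mult_nonneg_nonneg sum_nonneg add_nonneg_nonneg)
    moreover have "0 \<le> K * (V powr (p / 2 - 1) * v k + w k)" using K vw by (auto intro!: mult_nonneg_nonneg add_nonneg_nonneg)
    ultimately show "K * (V powr (p / 2 - 1) * v k + w k) \<le> exp (K * (\<Sum>b<Suc k. v b) / V) * (K * (V powr (p / 2 - 1) * v k + w k))"
      by (simp add: mult_le_cancel_right1)
  qed auto
  also have "\<dots> = exp (K * (\<Sum>b<Suc k. v b) / V) * K * (V powr (p / 2 - 1) * (\<Sum>b<Suc k. v b) + (\<Sum>b<Suc k. w b))"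
    by (simp add: algebra_simps add_divide_distrib exp_add)
  finally show ?case by (simp add: K_def v_def w_def c_def)
qed

text \<open>Taking \<open>V\<close> to be the total variance makes the exponential a constant and
  merges \<open>V powr (p / 2 - 1)\<close> with the variance. If the total variance is 0, all the
  variables vanish.\<close>

lemma rosenthal_symmetric:
  fixes Y :: "nat \<Rightarrow> 'a \<Rightarrow> real"
  assumes p: "2 \<le> p" and A: "finite A" "A \<noteq> {}"
    and sym: "bij_betw \<nu> A A" "\<And>b a. a \<in> A \<Longrightarrow> Y b (\<nu> a) = - Y b a"
  shows "(\<Sum>\<alpha>\<in>PiE {..<k} (\<lambda>_. A). \<bar>\<Sum>b<k. Y b (\<alpha> b)\<bar> powr p) / card A ^ k
    \<le> exp (rosenthal_const p) * rosenthal_const p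
       * ((\<Sum>b<k. (\<Sum>a\<in>A. (Y b a)\<^sup>2) / card A) powr (p / 2)
          + (\<Sum>b<k. (\<Sum>a\<in>A. \<bar>Y b a\<bar> powr p) / card A))"
proof -
  define S where "S = (\<Sum>b<k. (\<Sum>a\<in>A. (Y b a)\<^sup>2) / card A)"
  have c: "real (card A) > 0" using A by (simp add: card_gt_0_iff)
  have nn: "0 \<le> (\<Sum>b<k. (\<Sum>a\<in>A. \<bar>Y b a\<bar> powr p) / card A)"
    by (intro sum_nonneg divide_nonneg_nonneg) auto
  have "S \<ge> 0" unfolding S_def by (intro sum_nonneg divide_nonneg_nonneg) auto
  then consider "S > 0" | "S = 0" by linarith
  then show ?thesis
  proof cases
    case 1
    have "S powr (p / 2 - 1) * S = S powr (p / 2)"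
      using 1 powr_mult_base[of S "p / 2 - 1"] by (simp add: mult.commute)
    then show ?thesis
      using rosenthal_aux[of p A \<nu> Y, OF p A sym 1, of k] 1 by (simp add: S_def[symmetric])
  next
    case 2
    have "(\<Sum>a\<in>A. (Y b a)\<^sup>2) / card A = 0" if "b < k" for b
      using 2 that sum_nonneg_eq_0_iff[of "{..<k}" "\<lambda>b. (\<Sum>a\<in>A. (Y b a)\<^sup>2) / card A"]
      by (auto simp: S_def sum_nonneg)
    then have "Y b a = 0" if "b < k" "a \<in> A" for a b
      using that c A sum_nonneg_eq_0_iff[of A "\<lambda>a. (Y b a)\<^sup>2"] by fastforce
    then have "(\<Sum>b<k. Y b (\<alpha> b)) = 0" if "\<alpha> \<in> PiE {..<k} (\<lambda>_. A)" for \<alpha>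
      using that by (auto simp: PiE_iff)
    then have "(\<Sum>\<alpha>\<in>PiE {..<k} (\<lambda>_. A). \<bar>\<Sum>b<k. Y b (\<alpha> b)\<bar> powr p) = 0"
      using p by simp
    then show ?thesis
      using nn rosenthal_const_pos[of p] by simp
  qed
qed

section \<open>Product weights and their scores\<close>

text \<open>Expectation over a random vector indexed by \<open>J\<close> whose coordinates are
  independent with common law \<open>\<rho>\<close> on \<open>R\<close>.\<close>

definition expect :: "'j set \<Rightarrow> 'a set \<Rightarrow> ('a \<Rightarrow> real) \<Rightarrow> (('j \<Rightarrow> 'a) \<Rightarrow> real) \<Rightarrow> real" where
  "expect J R \<rho> \<psi> = (\<Sum>z\<in>PiE J (\<lambda>_. R). (\<Prod>j\<in>J. \<rho> (z j)) * \<psi> z)"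

locale product_weights =
  fixes J :: "'j set" and R :: "'a set" and \<rho> :: "'a \<Rightarrow> real"
  assumes finite_J: "finite J" and finite_R: "finite R"
    and \<rho>_nonneg: "\<And>i. 0 \<le> \<rho> i" and \<rho>_sum: "(\<Sum>i\<in>R. \<rho> i) = 1"
begin

abbreviation E :: "(('j \<Rightarrow> 'a) \<Rightarrow> real) \<Rightarrow> real" where "E \<equiv> expect J R \<rho>"

lemma finite_PiE_J: "finite (PiE J (\<lambda>_. R))"
  by (intro finite_PiE finite_J finite_R)

lemma weight_nonneg: "0 \<le> (\<Prod>j\<in>J. \<rho> (z j))"
  by (intro prod_nonneg) (simp add: \<rho>_nonneg)

lemma weight_sum: "(\<Sum>z\<in>PiE J (\<lambda>_. R). \<Prod>j\<in>J. \<rho> (z j)) = 1"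
  using prod_sum_PiE[of J "\<lambda>_. R" "\<lambda>_. \<rho>"] finite_J finite_R by (simp add: \<rho>_sum)

lemma E_const: "E (\<lambda>_. c) = c"
  by (simp add: expect_def sum_distrib_right[symmetric] weight_sum)

lemma E_mono: "(\<And>z. z \<in> PiE J (\<lambda>_. R) \<Longrightarrow> \<psi> z \<le> \<psi>' z) \<Longrightarrow> E \<psi> \<le> E \<psi>'"
  unfolding expect_def by (intro sum_mono mult_left_mono weight_nonneg)

lemma E_cong: "(\<And>z. z \<in> PiE J (\<lambda>_. R) \<Longrightarrow> \<psi> z = \<psi>' z) \<Longrightarrow> E \<psi> = E \<psi>'"
  unfolding expect_def by (intro sum.cong) auto

lemma E_nonneg: "(\<And>z. z \<in> PiE J (\<lambda>_. R) \<Longrightarrow> 0 \<le> \<psi> z) \<Longrightarrow> 0 \<le> E \<psi>"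
  unfolding expect_def by (intro sum_nonneg mult_nonneg_nonneg weight_nonneg)

lemma E_add: "E (\<lambda>z. \<psi> z + \<psi>' z) = E \<psi> + E \<psi>'"
  by (simp add: expect_def distrib_left sum.distrib)

lemma E_diff: "E (\<lambda>z. \<psi> z - \<psi>' z) = E \<psi> - E \<psi>'"
  by (simp add: expect_def right_diff_distrib sum_subtractf)

lemma E_cmult: "E (\<lambda>z. c * \<psi> z) = c * E \<psi>"
  by (simp add: expect_def sum_distrib_left mult.left_commute)

lemma E_sum: "E (\<lambda>z. \<Sum>i\<in>A. \<psi> i z) = (\<Sum>i\<in>A. E (\<psi> i))"
  unfolding expect_def by (simp add: sum_distrib_left) (rule sum.swap)

lemma E_powr_le:
  assumes "1 \<le> p" shows "\<bar>E \<psi>\<bar> powr p \<le> E (\<lambda>z. \<bar>\<psi> z\<bar> powr p)"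
  using abs_sum_powr_le[OF assms finite_PiE_J, of "\<lambda>z. \<Prod>j\<in>J. \<rho> (z j)" \<psi>]
  by (simp add: expect_def abs_of_nonneg[OF weight_nonneg] weight_sum)

text \<open>By Fubini, replacing one coordinate by an independent copy leaves the law unchanged.
  This reduces statements about a coordinate to one-dimensional sums.\<close>

lemma E_resample:
  assumes "j \<in> J"
  shows "E \<psi> = E (\<lambda>z. \<Sum>i\<in>R. \<rho> i * \<psi> (z(j := i)))"
proof -
  define J' where "J' = J - {j}"
  have J: "J = insert j J'" "j \<notin> J'" "finite J'" using assms finite_J by (auto simp: J'_def)
  define m where "m = (\<lambda>f :: 'j \<Rightarrow> 'a. \<Prod>x\<in>J'. \<rho> (f x))"
  have prod: "(\<Prod>x\<in>J. \<rho> ((f(j := a)) x)) = \<rho> a * m f" for f a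
  proof -
    have "(\<Prod>x\<in>J'. \<rho> ((f(j := a)) x)) = m f"
      unfolding m_def using J by (intro prod.cong) auto
    then show ?thesis using J by simp
  qed
  have split: "E \<psi> = (\<Sum>a\<in>R. \<Sum>f\<in>PiE J' (\<lambda>_. R). \<rho> a * m f * \<psi> (f(j := a)))" for \<psi>
  proof -
    have "E \<psi> = (\<Sum>a\<in>R. \<Sum>f\<in>PiE J' (\<lambda>_. R). (\<Prod>x\<in>J. \<rho> ((f(j := a)) x)) * \<psi> (f(j := a)))"
      unfolding expect_def by (subst (1) J(1), subst sum_PiE_insert[OF J(2)]) simp
    then show ?thesis by (simp only: prod)
  qed
  have "E (\<lambda>z. \<Sum>i\<in>R. \<rho> i * \<psi> (z(j := i)))
      = (\<Sum>a\<in>R. \<rho> a * (\<Sum>f\<in>PiE J' (\<lambda>_. R). m f * (\<Sum>i\<in>R. \<rho> i * \<psi> (f(j := i)))))"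
    by (subst split) (simp add: sum_distrib_left mult.assoc)
  also have "\<dots> = (\<Sum>f\<in>PiE J' (\<lambda>_. R). m f * (\<Sum>i\<in>R. \<rho> i * \<psi> (f(j := i))))"
    by (simp add: sum_distrib_right[symmetric] \<rho>_sum)
  also have "\<dots> = (\<Sum>f\<in>PiE J' (\<lambda>_. R). \<Sum>i\<in>R. \<rho> i * m f * \<psi> (f(j := i)))"
    by (simp add: sum_distrib_left algebra_simps)
  also have "\<dots> = E \<psi>" unfolding split by (rule sum.swap)
  finally show ?thesis by simp
qed

lemma E_coordinate:
  assumes "j \<in> J"
  shows "E (\<lambda>z. h (z j)) = (\<Sum>i\<in>R. \<rho> i * h i)"
  by (subst E_resample[OF assms]) (simp add: E_const)

text \<open>A function that ignores coordinate \<open>j\<close> is independent of the mean-zero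
  variable \<open>s (z j)\<close>.\<close>

lemma E_score_mult:
  assumes "j \<in> J" and "(\<Sum>i\<in>R. \<rho> i * s i) = 0" and "\<And>z i. \<psi> (z(j := i)) = \<psi> z"
  shows "E (\<lambda>z. s (z j) * \<psi> z) = 0"
proof -
  have "E (\<lambda>z. s (z j) * \<psi> z) = E (\<lambda>z. (\<Sum>i\<in>R. \<rho> i * s i) * \<psi> z)"
    by (subst E_resample[OF assms(1)]) (simp add: assms(3) sum_distrib_right mult.assoc)
  then show ?thesis by (simp add: assms(2) E_const)
qed

text \<open>The variables \<open>s (z j)\<close> are orthogonal with common variance at most
  \<open>\<kappa>\<close>. Expanding the nonnegative expectation of the square of
  \<open>\<psi> - T / \<kappa>\<close>, with \<open>T\<close> the combination whose coefficients are
  the inner products, gives Bessel's inequality; dividing by the bound \<open>\<kappa>\<close>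
  instead of the variance covers variance 0.\<close>

lemma bessel_scores:
  assumes s: "(\<Sum>i\<in>R. \<rho> i * s i) = 0" "(\<Sum>i\<in>R. \<rho> i * (s i)\<^sup>2) \<le> \<kappa>" and "\<kappa> > 0"
  shows "(\<Sum>j\<in>J. (E (\<lambda>z. s (z j) * \<psi> z))\<^sup>2) \<le> \<kappa> * E (\<lambda>z. (\<psi> z)\<^sup>2)"
proof -
  define y where "y = (\<lambda>j. E (\<lambda>z. s (z j) * \<psi> z))"
  define S where "S = (\<Sum>j\<in>J. (y j)\<^sup>2)"
  define T where "T = (\<lambda>z. \<Sum>j\<in>J. y j * s (z j))"
  define \<mu> where "\<mu> = (\<Sum>i\<in>R. \<rho> i * (s i)\<^sup>2)"
  have S: "S \<ge> 0" by (auto simp: S_def intro!: sum_nonneg)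
  have 1: "E (\<lambda>z. T z * \<psi> z) = S"
    unfolding T_def S_def
    by (simp add: sum_distrib_right E_sum mult.assoc E_cmult y_def power2_eq_square)
  have 2: "E (\<lambda>z. s (z i) * s (z j)) = (if i = j then \<mu> else 0)" if "i \<in> J" "j \<in> J" for i j
  proof (cases "i = j")
    case True
    then show ?thesis using E_coordinate[OF that(1), of "\<lambda>i. (s i)\<^sup>2"] by (simp add: power2_eq_square \<mu>_def)
  next
    case False
    then show ?thesis using that s by (auto intro!: E_score_mult)
  qed
  have "E (\<lambda>z. (T z)\<^sup>2) = (\<Sum>i\<in>J. \<Sum>j\<in>J. y i * y j * E (\<lambda>z. s (z i) * s (z j)))"
  proof -
    have "(T z)\<^sup>2 = (\<Sum>i\<in>J. \<Sum>j\<in>J. (y i * y j) * (s (z i) * s (z j)))" for z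
      unfolding T_def power2_eq_square sum_product by (intro sum.cong refl) (simp add: mult_ac)
    then show ?thesis by (simp add: E_sum E_cmult)
  qed
  also have "\<dots> = (\<Sum>i\<in>J. \<Sum>j\<in>J. if j = i then y i * y j * \<mu> else 0)"
    by (intro sum.cong refl) (auto simp: 2)
  also have "\<dots> = \<mu> * S"
    using finite_J by (simp add: S_def sum_distrib_left power2_eq_square mult_ac)
  finally have 3: "E (\<lambda>z. (T z)\<^sup>2) = \<mu> * S" .
  have "0 \<le> E (\<lambda>z. (\<psi> z - T z / \<kappa>)\<^sup>2)" by (intro E_nonneg) auto
  also have "(\<lambda>z. (\<psi> z - T z / \<kappa>)\<^sup>2) = (\<lambda>z. (\<psi> z)\<^sup>2 - (2 / \<kappa>) * (T z * \<psi> z) + (1 / \<kappa>\<^sup>2) * (T z)\<^sup>2)"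
    using \<open>\<kappa> > 0\<close> by (intro ext) (simp add: field_simps power2_eq_square)
  also have "E \<dots> = E (\<lambda>z. (\<psi> z)\<^sup>2) - (2 / \<kappa>) * S + (1 / \<kappa>\<^sup>2) * (\<mu> * S)"
    by (simp only: E_add E_diff E_cmult 1 3)
  also have "(1 / \<kappa>\<^sup>2) * (\<mu> * S) \<le> (1 / \<kappa>\<^sup>2) * (\<kappa> * S)"
    using s(2) S by (intro mult_left_mono mult_right_mono) (auto simp: \<mu>_def)
  finally have "0 \<le> X - (2 / \<kappa>) * S + (1 / \<kappa>\<^sup>2) * (\<kappa> * S)" if "X = E (\<lambda>z. (\<psi> z)\<^sup>2)" for X
    by (simp add: that)
  then have "S \<le> \<kappa> * E (\<lambda>z. (\<psi> z)\<^sup>2)"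
    using \<open>\<kappa> > 0\<close> by (simp add: field_simps power2_eq_square)
  then show ?thesis by (simp add: S_def y_def)
qed

end

section \<open>A discrete mollifier and its score\<close>

lemma cube_le_sum_squares: "real N ^ 3 / 3 \<le> (\<Sum>d<N. (real (Suc d))\<^sup>2)"
  by (induction N) (auto simp: power2_eq_square power3_eq_cube field_simps)

text \<open>The weights are proportional to \<open>(N - \<bar>i\<bar>)\<^sup>2\<close>: vanishing to second order at the ends of
  the interval makes the score \<open>s\<close> square integrable, which fails for triangular weights. The shifted weight is
  nonzero at \<open>i = N\<close> although \<open>\<rho> N = 0\<close>; this mass \<open>\<beta>\<close> is moved to the origin, which
  keeps the mean of \<open>s\<close> equal to zero.\<close>

lemma quadratic_weights:
  fixes N :: nat
  assumes "N \<ge> 1"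
  obtains \<rho> s :: "int \<Rightarrow> real" and \<beta> :: real where
    "\<And>i. 0 \<le> \<rho> i" "(\<Sum>i\<in>{-int N..int N}. \<rho> i) = 1"
    "(\<Sum>i\<in>{-int N..int N}. \<rho> i * s i) = 0"
    "(\<Sum>i\<in>{-int N..int N}. \<rho> i * (s i)\<^sup>2) \<le> 54 / real N ^ 2"
    "0 \<le> \<beta>" "\<beta> \<le> 3 / real N ^ 3"
    "\<And>\<psi>. (\<Sum>i\<in>{-int N..int N}. \<rho> i * \<psi> (i + 1)) - (\<Sum>i\<in>{-int N..int N}. \<rho> i * \<psi> i)
        = (\<Sum>i\<in>{-int N..int N}. \<rho> i * s i * \<psi> i) + \<beta> * (\<psi> (int N) - \<psi> 0)"
proof -
  define R where "R = {-int N..int N}"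
  have R: "finite R" by (simp add: R_def)
  define u where "u = (\<lambda>i::int. (real_of_int (max 0 (int N - \<bar>i\<bar>)))\<^sup>2)"
  define Z where "Z = (\<Sum>i\<in>R. u i)"
  \<comment> \<open>The backward difference of \<open>u\<close>, corrected so that it vanishes at
    \<open>i = N\<close>, where \<open>u\<close> vanishes but its shift equals 1; the compensating
    unit mass sits at 0.\<close>
  define e where "e = (\<lambda>i::int. u (i - 1) - u i + of_bool (i = 0) - of_bool (i = int N))"
  define s where "s = (\<lambda>i. if u i = 0 then 0 else e i / u i)"
  have u0: "u i \<ge> 0" for i by (simp add: u_def)
  \<comment> \<open>The half \<open>0 \<le> i < N\<close> alone contributes the squares of
    \<open>1, ..., N\<close>; hence the normaliser has order at least \<open>N^3\<close> and the
    moved mass \<open>1 / Z\<close> order at most \<open>N^-3\<close>.\<close>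
  have "real N ^ 3 / 3 \<le> (\<Sum>d<N. (real (Suc d))\<^sup>2)" by (rule cube_le_sum_squares)
  also have "\<dots> = (\<Sum>d<N. (real (N - d))\<^sup>2)"
    by (subst sum.nat_diff_reindex[symmetric]) (intro sum.cong, auto)
  also have "\<dots> = (\<Sum>i\<in>int ` {..<N}. u i)"
    by (subst sum.reindex) (auto simp: u_def of_nat_diff intro!: sum.cong)
  also have "\<dots> \<le> Z"
    unfolding Z_def by (intro sum_mono2) (auto simp: R_def u0)
  finally have Z: "real N ^ 3 / 3 \<le> Z" .
  have Zpos: "Z > 0" using Z assms by (smt (verit) divide_pos_pos of_nat_0_less_iff zero_less_power less_le_trans not_one_le_zero neq0_conv)
  have us: "u i * s i = e i" if "i \<in> R" for i
  proof (cases "\<bar>i\<bar> < int N")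
    case True
    then show ?thesis by (auto simp: s_def u_def)
  next
    case False
    then have "i = int N \<or> i = - int N" using that by (auto simp: R_def)
    then show ?thesis using assms by (auto simp: s_def u_def e_def max_def)
  qed
  \<comment> \<open>At distance \<open>d\<close> from the ends \<open>u\<close> equals
    \<open>d^2\<close>, while its difference has size at most \<open>3 * d\<close>, so the quotient
    \<open>e^2 / u\<close> stays bounded.\<close>
  have us2: "u i * (s i)\<^sup>2 \<le> 9 * of_bool (i \<noteq> int N)" if "i \<in> R" for i
  proof (cases "\<bar>i\<bar> < int N")
    case True
    define d where "d = real_of_int (int N - \<bar>i\<bar>)"
    have d: "d \<ge> 1" "u i = d\<^sup>2" using True by (auto simp: d_def u_def)
    have "\<bar>e i\<bar> \<le> 3 * d"
    proof (cases "i > 0")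
      case True
      then have "u (i - 1) = (d + 1)\<^sup>2" using \<open>\<bar>i\<bar> < int N\<close> by (auto simp: u_def d_def)
      then have "e i = 2 * d + 1" using True \<open>\<bar>i\<bar> < int N\<close> d by (auto simp: e_def power2_eq_square algebra_simps)
      then show ?thesis using d by simp
    next
      case False
      then have "u (i - 1) = (d - 1)\<^sup>2" using \<open>\<bar>i\<bar> < int N\<close> by (auto simp: u_def d_def)
      then have "e i = - 2 * d + 1 + of_bool (i = 0)" using False \<open>\<bar>i\<bar> < int N\<close> d by (auto simp: e_def power2_eq_square algebra_simps)
      then show ?thesis using d by auto
    qed
    then have "(e i)\<^sup>2 \<le> (3 * d)\<^sup>2" using abs_le_square_iff[of "e i" "3 * d"] d by simp
    then have "(e i)\<^sup>2 / u i \<le> 9" using d by (simp add: field_simps power2_eq_square)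
    moreover have "u i * (s i)\<^sup>2 = (e i)\<^sup>2 / u i" using d by (auto simp: s_def power2_eq_square)
    ultimately show ?thesis using True by auto
  qed (auto simp: s_def u_def)
  \<comment> \<open>Summation by parts leaves no boundary terms, since \<open>u\<close> vanishes at
    \<open>N\<close> and at \<open>- N - 1\<close>.\<close>
  have shift: "(\<Sum>i\<in>R. u i * \<psi> (i + 1)) = (\<Sum>i\<in>R. u (i - 1) * \<psi> i)" for \<psi>
  proof -
    have "(\<Sum>i\<in>R. u i * \<psi> (i + 1)) = (\<Sum>i\<in>{-int N..int N - 1}. u i * \<psi> (i + 1))"
      by (intro sum.mono_neutral_right) (auto simp: R_def u_def)
    also have "\<dots> = (\<Sum>i\<in>{-int N + 1..int N}. u (i - 1) * \<psi> i)"
      by (rule sum.reindex_bij_witness[of _ "\<lambda>i. i - 1" "\<lambda>i. i + 1"]) auto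
    also have "\<dots> = (\<Sum>i\<in>R. u (i - 1) * \<psi> i)"
      by (intro sum.mono_neutral_left) (auto simp: R_def u_def)
    finally show ?thesis .
  qed
  have diff: "(\<Sum>i\<in>R. u i * \<psi> (i + 1)) - (\<Sum>i\<in>R. u i * \<psi> i) = (\<Sum>i\<in>R. u i * s i * \<psi> i) + (\<psi> (int N) - \<psi> 0)" for \<psi>
  proof -
    have "(\<Sum>i\<in>R. u i * s i * \<psi> i) = (\<Sum>i\<in>R. e i * \<psi> i)" by (intro sum.cong) (auto simp: us)
    also have "\<dots> = (\<Sum>i\<in>R. u (i - 1) * \<psi> i) - (\<Sum>i\<in>R. u i * \<psi> i)
        + (\<Sum>i\<in>R. if i = 0 then \<psi> i else 0) - (\<Sum>i\<in>R. if i = int N then \<psi> i else 0)"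
      unfolding sum_subtractf[symmetric] sum.distrib[symmetric]
      by (intro sum.cong) (auto simp: e_def algebra_simps)
    also have "(\<Sum>i\<in>R. if i = 0 then \<psi> i else 0) = \<psi> 0" using R by (simp add: R_def)
    also have "(\<Sum>i\<in>R. if i = int N then \<psi> i else 0) = \<psi> (int N)" using R by (simp add: R_def)
    finally show ?thesis by (simp add: shift)
  qed
  show ?thesis
  proof (rule that[of "\<lambda>i. u i / Z" s "1 / Z", folded R_def])
    show "0 \<le> u i / Z" for i using u0 Zpos by simp
    show "(\<Sum>i\<in>R. u i / Z) = 1" using Zpos by (simp add: sum_divide_distrib[symmetric] Z_def[symmetric])
    show "(\<Sum>i\<in>R. u i / Z * s i) = 0"
      using diff[of "\<lambda>_. 1"] by (simp add: sum_divide_distrib[symmetric])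
    \<comment> \<open>Without the endpoint \<open>N\<close> there remain \<open>2 * N\<close>
      points, each contributing at most 9; dividing \<open>18 * N\<close> by \<open>N^3 / 3\<close>
      produces the constant 54.\<close>
    have "(\<Sum>i\<in>R. u i * (s i)\<^sup>2) \<le> (\<Sum>i\<in>R. 9 * of_bool (i \<noteq> int N))"
      by (intro sum_mono us2)
    also have "\<dots> = (\<Sum>i\<in>R - {int N}. 9)"
      by (intro sum.mono_neutral_cong_right R) auto
    also have "\<dots> = 18 * real N" using R by (simp add: R_def card_Diff_singleton)
    finally have "(\<Sum>i\<in>R. u i * (s i)\<^sup>2) \<le> 18 * real N" .
    then have "(\<Sum>i\<in>R. u i / Z * (s i)\<^sup>2) \<le> 18 * real N / Z"
      using Zpos by (simp add: sum_divide_distrib[symmetric] divide_right_mono)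
    also have "\<dots> \<le> 18 * real N / (real N ^ 3 / 3)"
      using Z Zpos assms by (intro divide_left_mono) auto
    also have "\<dots> = 54 / real N ^ 2" using assms by (simp add: field_simps power2_eq_square power3_eq_cube)
    finally show "(\<Sum>i\<in>R. u i / Z * (s i)\<^sup>2) \<le> 54 / real N ^ 2" .
    show "0 \<le> 1 / Z" using Zpos by simp
    have "1 / Z \<le> 1 / (real N ^ 3 / 3)" using Z assms Zpos by (intro divide_left_mono) auto
    then show "1 / Z \<le> 3 / real N ^ 3" by simp
    show "(\<Sum>i\<in>R. u i / Z * \<psi> (i + 1)) - (\<Sum>i\<in>R. u i / Z * \<psi> i)
        = (\<Sum>i\<in>R. u i / Z * s i * \<psi> i) + 1 / Z * (\<psi> (int N) - \<psi> 0)" for \<psi>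
      using arg_cong[OF diff[of \<psi>], of "\<lambda>x. x / Z"]
      by (simp add: sum_divide_distrib[symmetric] diff_divide_distrib add_divide_distrib)
  qed
qed

section \<open>Mollified maps on the integer lattice\<close>

definition Lp_fun :: "'w measure \<Rightarrow> real \<Rightarrow> ('w \<Rightarrow> real) set" where
  "Lp_fun M p = {h \<in> borel_measurable M. integrable M (\<lambda>\<omega>. \<bar>h \<omega>\<bar> powr p)}"

definition moment :: "'w measure \<Rightarrow> real \<Rightarrow> ('w \<Rightarrow> real) \<Rightarrow> real" where
  "moment M p h = (\<integral>\<omega>. \<bar>h \<omega>\<bar> powr p \<partial>M)"

lemma moment_nonneg: "0 \<le> moment M p h"
  by (simp add: moment_def)

lemma Lp_fun_lincomb:
  fixes w :: "'i \<Rightarrow> real"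
  assumes "1 \<le> p" "finite A" "\<And>i. i \<in> A \<Longrightarrow> h i \<in> Lp_fun M p"
  shows "(\<lambda>\<omega>. \<Sum>i\<in>A. w i * h i \<omega>) \<in> Lp_fun M p"
    and "moment M p (\<lambda>\<omega>. \<Sum>i\<in>A. w i * h i \<omega>)
      \<le> (\<Sum>i\<in>A. \<bar>w i\<bar>) powr (p - 1) * (\<Sum>i\<in>A. \<bar>w i\<bar> * moment M p (h i))"
proof -
  define D where "D = (\<lambda>\<omega>. (\<Sum>i\<in>A. \<bar>w i\<bar>) powr (p - 1) * (\<Sum>i\<in>A. \<bar>w i\<bar> * \<bar>h i \<omega>\<bar> powr p))"
  have meas: "h i \<in> borel_measurable M" and int: "integrable M (\<lambda>\<omega>. \<bar>h i \<omega>\<bar> powr p)" if "i \<in> A" for i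
    using assms(3)[OF that] by (auto simp: Lp_fun_def)
  have m: "(\<lambda>\<omega>. \<Sum>i\<in>A. w i * h i \<omega>) \<in> borel_measurable M"
    using meas by (intro borel_measurable_sum borel_measurable_times) auto
  have D: "integrable M D"
    unfolding D_def using int by (intro integrable_mult_right integrable_sum) auto
  have le: "\<bar>\<Sum>i\<in>A. w i * h i \<omega>\<bar> powr p \<le> D \<omega>" for \<omega>
    unfolding D_def by (rule abs_sum_powr_le) (use assms in auto)
  have i: "integrable M (\<lambda>\<omega>. \<bar>\<Sum>i\<in>A. w i * h i \<omega>\<bar> powr p)"
    by (rule Bochner_Integration.integrable_bound[OF D]) (use m le in \<open>auto intro!: AE_I2 order_trans[OF le]\<close>)
  show "(\<lambda>\<omega>. \<Sum>i\<in>A. w i * h i \<omega>) \<in> Lp_fun M p"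
    using m i by (simp add: Lp_fun_def)
  have "moment M p (\<lambda>\<omega>. \<Sum>i\<in>A. w i * h i \<omega>) \<le> (\<integral>\<omega>. D \<omega> \<partial>M)"
    unfolding moment_def by (intro integral_mono i D le)
  also have "\<dots> = (\<Sum>i\<in>A. \<bar>w i\<bar>) powr (p - 1) * (\<Sum>i\<in>A. \<bar>w i\<bar> * moment M p (h i))"
    unfolding D_def moment_def using int by (simp add: Bochner_Integration.integral_sum)
  finally show "moment M p (\<lambda>\<omega>. \<Sum>i\<in>A. w i * h i \<omega>)
      \<le> (\<Sum>i\<in>A. \<bar>w i\<bar>) powr (p - 1) * (\<Sum>i\<in>A. \<bar>w i\<bar> * moment M p (h i))" .
qed

lemma Lp_fun_sum:
  assumes "1 \<le> p" "finite A" "\<And>i. i \<in> A \<Longrightarrow> h i \<in> Lp_fun M p"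
  shows "(\<lambda>\<omega>. \<Sum>i\<in>A. h i \<omega>) \<in> Lp_fun M p"
    and "moment M p (\<lambda>\<omega>. \<Sum>i\<in>A. h i \<omega>) \<le> real (card A) powr (p - 1) * (\<Sum>i\<in>A. moment M p (h i))"
  using Lp_fun_lincomb[OF assms, where w="\<lambda>_. 1"] by simp_all

lemma Lp_fun_add:
  assumes "1 \<le> p" "f \<in> Lp_fun M p" "g \<in> Lp_fun M p"
  shows "(\<lambda>\<omega>. f \<omega> + g \<omega>) \<in> Lp_fun M p"
    and "moment M p (\<lambda>\<omega>. f \<omega> + g \<omega>) \<le> 2 powr (p - 1) * (moment M p f + moment M p g)"
  using Lp_fun_sum[of p "UNIV :: bool set" "\<lambda>b. if b then f else g" M] assms
  by (simp_all add: UNIV_bool add.commute)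

lemma Lp_fun_cmult:
  assumes "1 \<le> p" "f \<in> Lp_fun M p"
  shows "(\<lambda>\<omega>. c * f \<omega>) \<in> Lp_fun M p"
    and "moment M p (\<lambda>\<omega>. c * f \<omega>) = \<bar>c\<bar> powr p * moment M p f"
  using Lp_fun_lincomb(1)[of p "{()}" "\<lambda>_. f" M "\<lambda>_. c"] assms
  by (simp_all add: moment_def abs_mult powr_mult)

lemma Lp_fun_diff:
  assumes "1 \<le> p" "f \<in> Lp_fun M p" "g \<in> Lp_fun M p"
  shows "(\<lambda>\<omega>. f \<omega> - g \<omega>) \<in> Lp_fun M p"
  using Lp_fun_add(1)[OF assms(1,2) Lp_fun_cmult(1)[OF assms(1,3), of "-1"]] by simp

text \<open>\<open>F\<close> stands for an embedding composed with the grid of mesh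
  \<open>1 / N\<close> in ell_q. Its p-th moments grow like the \<open>\<gamma>\<close>-th power of
  the q-th power of the distance. Lattice distance \<open>N\<close> is the unit scale of the
  mollifier, whose law and score are \<open>\<rho>\<close> and \<open>s\<close>.\<close>

locale lattice_map =
  fixes M :: "'w measure" and p q \<gamma> K :: real and N :: nat and J :: "'j set"
    and F :: "('j \<Rightarrow> int) \<Rightarrow> 'w \<Rightarrow> real" and \<rho> s :: "int \<Rightarrow> real" and \<beta> :: real
  assumes p: "2 \<le> p" and q: "0 < q" and \<gamma>: "0 < \<gamma>" and K: "0 \<le> K" and N: "1 \<le> N"
    and finite_J': "finite J"
    and F_Lp: "\<And>x. F x \<in> Lp_fun M p"
    and F_modulus: "\<And>x y. moment M p (\<lambda>\<omega>. F x \<omega> - F y \<omega>)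
        \<le> K * (\<Sum>j\<in>J. \<bar>real_of_int (x j - y j) / N\<bar> powr q) powr \<gamma>"
    and weights: "\<And>i. 0 \<le> \<rho> i" "(\<Sum>i\<in>{-int N..int N}. \<rho> i) = 1"
    and scores: "(\<Sum>i\<in>{-int N..int N}. \<rho> i * s i) = 0"
      "(\<Sum>i\<in>{-int N..int N}. \<rho> i * (s i)\<^sup>2) \<le> 54 / real N ^ 2"
    and \<beta>: "0 \<le> \<beta>" "\<beta> \<le> 3 / real N ^ 3"
    and by_parts: "\<And>\<psi>. (\<Sum>i\<in>{-int N..int N}. \<rho> i * \<psi> (i + 1)) - (\<Sum>i\<in>{-int N..int N}. \<rho> i * \<psi> i)
        = (\<Sum>i\<in>{-int N..int N}. \<rho> i * s i * \<psi> i) + \<beta> * (\<psi> (int N) - \<psi> 0)"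
begin

sublocale product_weights J "{-int N..int N}" \<rho>
  by unfold_locales (use finite_J' weights in auto)

abbreviation box where "box \<equiv> PiE J (\<lambda>_. {-int N..int N})"
abbreviation mom where "mom \<equiv> moment M p"

text \<open>\<open>Y j\<close> is the derivative of \<open>G\<close> in direction \<open>j\<close> up to the boundary term
  \<open>B j\<close>, which is of lower order in \<open>1 / N\<close>.\<close>

definition G where "G x \<omega> = E (\<lambda>z. F (\<lambda>i. x i + z i) \<omega>)"
definition Y where "Y j x \<omega> = E (\<lambda>z. s (z j) * F (\<lambda>i. x i + z i) \<omega>)"
definition B where "B j x \<omega> = \<beta> * E (\<lambda>z. F (\<lambda>i. x i + (z(j := int N)) i) \<omega> - F (\<lambda>i. x i + (z(j := 0)) i) \<omega>)"

lemma p1: "1 \<le> p" using p by simp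

text \<open>Raising \<open>x j\<close> by one has the same effect as raising the resampled
  \<open>z j\<close> by one, so the difference is the one-dimensional summation by parts, averaged
  over the other coordinates.\<close>

lemma G_step:
  assumes "j \<in> J"
  shows "G (x(j := x j + 1)) \<omega> - G x \<omega> = Y j x \<omega> + B j x \<omega>"
proof -
  define \<psi> where "\<psi> = (\<lambda>z i. F (\<lambda>l. x l + (z(j := i)) l) \<omega>)"
  have G': "G (x(j := x j + 1)) \<omega> = E (\<lambda>z. \<Sum>i\<in>{-int N..int N}. \<rho> i * \<psi> z (i + 1))"
  proof -
    have "(\<lambda>l. (x(j := x j + 1)) l + (z(j := i)) l) = (\<lambda>l. x l + (z(j := i + 1)) l)" for z :: "'j \<Rightarrow> int" and i
      by auto
    then show ?thesis
      unfolding G_def \<psi>_def by (subst E_resample[OF assms]) simp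
  qed
  have G: "G x \<omega> = E (\<lambda>z. \<Sum>i\<in>{-int N..int N}. \<rho> i * \<psi> z i)"
    unfolding G_def \<psi>_def by (rule E_resample[OF assms])
  have Y: "Y j x \<omega> = E (\<lambda>z. \<Sum>i\<in>{-int N..int N}. \<rho> i * s i * \<psi> z i)"
    unfolding Y_def \<psi>_def by (subst E_resample[OF assms]) (simp add: mult.assoc)
  have B: "B j x \<omega> = E (\<lambda>z. \<beta> * (\<psi> z (int N) - \<psi> z 0))"
    unfolding B_def \<psi>_def by (simp only: E_cmult)
  show ?thesis
    unfolding G' G Y B E_diff[symmetric] E_add[symmetric] by (rule E_cong, rule by_parts)
qed

lemma Lp_E:
  assumes "\<And>z. z \<in> box \<Longrightarrow> h z \<in> Lp_fun M p"
  shows "(\<lambda>\<omega>. E (\<lambda>z. c z * h z \<omega>)) \<in> Lp_fun M p"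
    and "mom (\<lambda>\<omega>. E (\<lambda>z. c z * h z \<omega>)) \<le> E (\<lambda>z. \<bar>c z\<bar>) powr (p - 1) * E (\<lambda>z. \<bar>c z\<bar> * mom (h z))"
  using Lp_fun_lincomb[OF p1 finite_PiE_J assms, where w="\<lambda>z. (\<Prod>j\<in>J. \<rho> (z j)) * c z"]
  by (simp_all add: expect_def abs_mult abs_of_nonneg[OF weight_nonneg] mult.assoc)

text \<open>The triangle inequality in L_p for a weighted average, written with p-th powers: total
  absolute weight at most \<open>S\<close> costs the factor \<open>S powr p\<close>.\<close>

lemma mom_E_le:
  assumes "\<And>z. z \<in> box \<Longrightarrow> h z \<in> Lp_fun M p" "\<And>z. z \<in> box \<Longrightarrow> mom (h z) \<le> H" "0 \<le> H"
    and "E (\<lambda>z. \<bar>c z\<bar>) \<le> S"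
  shows "mom (\<lambda>\<omega>. E (\<lambda>z. c z * h z \<omega>)) \<le> S powr p * H"
proof -
  have c0: "0 \<le> E (\<lambda>z. \<bar>c z\<bar>)" by (intro E_nonneg) auto
  have "mom (\<lambda>\<omega>. E (\<lambda>z. c z * h z \<omega>)) \<le> E (\<lambda>z. \<bar>c z\<bar>) powr (p - 1) * E (\<lambda>z. \<bar>c z\<bar> * mom (h z))"
    by (rule Lp_E(2)) (rule assms(1))
  also have "E (\<lambda>z. \<bar>c z\<bar> * mom (h z)) \<le> E (\<lambda>z. H * \<bar>c z\<bar>)"
    by (rule E_mono) (metis assms(2) abs_ge_zero mult.commute mult_right_mono)
  also have "\<dots> = H * E (\<lambda>z. \<bar>c z\<bar>)" by (rule E_cmult)
  also have "E (\<lambda>z. \<bar>c z\<bar>) powr (p - 1) * (H * E (\<lambda>z. \<bar>c z\<bar>)) = E (\<lambda>z. \<bar>c z\<bar>) powr p * H"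
  proof (cases "E (\<lambda>z. \<bar>c z\<bar>) = 0")
    case False
    then show ?thesis using powr_mult_base[of "E (\<lambda>z. \<bar>c z\<bar>)" "p - 1"] c0 by (simp add: algebra_simps)
  qed (use p in simp)
  also have "\<dots> \<le> S powr p * H"
    using assms(3,4) c0 p by (intro mult_right_mono powr_mono2) auto
  finally show ?thesis by (simp add: mult_left_mono)
qed

text \<open>Cauchy-Schwarz against the variance of the score; 8 comes from
  \<open>54 \<le> 8^2\<close>.\<close>

lemma E_abs_score: assumes "j \<in> J" shows "E (\<lambda>z. \<bar>s (z j)\<bar>) \<le> 8 / N"
proof -
  have "(E (\<lambda>z. \<bar>s (z j)\<bar>))\<^sup>2 \<le> E (\<lambda>z. \<bar>s (z j)\<bar> powr 2)"
    using E_powr_le[of 2 "\<lambda>z. \<bar>s (z j)\<bar>"] by simp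
  also have "\<dots> = (\<Sum>i\<in>{-int N..int N}. \<rho> i * (s i)\<^sup>2)"
    using E_coordinate[OF assms, of "\<lambda>i. (s i)\<^sup>2"] by simp
  also have "\<dots> \<le> 54 / real N ^ 2" by (rule scores)
  also have "\<dots> \<le> (8 / N)\<^sup>2" by (simp add: power_divide divide_right_mono)
  finally show ?thesis by (rule power2_le_imp_le) simp
qed

lemma F_diff_Lp: "(\<lambda>\<omega>. F x \<omega> - F y \<omega>) \<in> Lp_fun M p"
  by (intro Lp_fun_diff p1 F_Lp)

lemma F_near:
  assumes "\<And>j. j \<in> J \<Longrightarrow> \<bar>x j - y j\<bar> \<le> int N"
  shows "mom (\<lambda>\<omega>. F x \<omega> - F y \<omega>) \<le> K * real (card J) powr \<gamma>"
proof -
  have "mom (\<lambda>\<omega>. F x \<omega> - F y \<omega>) \<le> K * (\<Sum>j\<in>J. \<bar>real_of_int (x j - y j) / N\<bar> powr q) powr \<gamma>"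
    by (rule F_modulus)
  also have "\<dots> \<le> K * (\<Sum>j\<in>J. 1) powr \<gamma>"
  proof (intro mult_left_mono powr_mono2 sum_mono K sum_nonneg)
    fix j assume "j \<in> J"
    then have "\<bar>real_of_int (x j - y j) / N\<bar> \<le> 1" using assms[of j] N by (simp add: divide_le_eq_1 flip: of_int_abs)
    then show "\<bar>real_of_int (x j - y j) / N\<bar> powr q \<le> 1" using q by (intro powr_le1) auto
  qed (use \<gamma> in auto)
  finally show ?thesis by simp
qed

lemma F_one_coordinate:
  assumes "j \<in> J" "\<bar>a - b\<bar> \<le> int N"
  shows "mom (\<lambda>\<omega>. F (\<lambda>i. x i + (z(j := a)) i) \<omega> - F (\<lambda>i. x i + (z(j := b)) i) \<omega>) \<le> K"
proof -
  define c where "c = \<bar>real_of_int (a - b) / N\<bar> powr q"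
  have c: "0 \<le> c" "c \<le> 1"
  proof -
    have "\<bar>real_of_int (a - b) / N\<bar> \<le> 1" using assms N by (simp add: divide_le_eq_1 flip: of_int_abs)
    then show "c \<le> 1" unfolding c_def using q by (intro powr_le1) auto
  qed (simp add: c_def)
  have "mom (\<lambda>\<omega>. F (\<lambda>i. x i + (z(j := a)) i) \<omega> - F (\<lambda>i. x i + (z(j := b)) i) \<omega>)
      \<le> K * (\<Sum>l\<in>J. \<bar>real_of_int ((x l + (z(j := a)) l) - (x l + (z(j := b)) l)) / N\<bar> powr q) powr \<gamma>"
    by (rule F_modulus)
  also have "(\<Sum>l\<in>J. \<bar>real_of_int ((x l + (z(j := a)) l) - (x l + (z(j := b)) l)) / N\<bar> powr q)
      = (\<Sum>l\<in>J. if l = j then c else 0)"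
    using q by (intro sum.cong) (auto simp: c_def)
  also have "\<dots> = c" using assms finite_J' by simp
  also have "K * c powr \<gamma> \<le> K * 1" using c \<gamma> K by (intro mult_left_mono powr_le1) auto
  finally show ?thesis by simp
qed

text \<open>Bound for the oscillation of \<open>F\<close> when every coordinate moves by at most one
  lattice step; it tends to 0 as \<open>N\<close> grows with \<open>J\<close> fixed.\<close>

definition \<epsilon> where "\<epsilon> = K * (card J / real N powr q) powr \<gamma>"

lemma F_fine:
  assumes "\<And>j. j \<in> J \<Longrightarrow> \<bar>x j - y j\<bar> \<le> 1"
  shows "mom (\<lambda>\<omega>. F x \<omega> - F y \<omega>) \<le> \<epsilon>"
proof -
  have "mom (\<lambda>\<omega>. F x \<omega> - F y \<omega>) \<le> K * (\<Sum>j\<in>J. \<bar>real_of_int (x j - y j) / N\<bar> powr q) powr \<gamma>"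
    by (rule F_modulus)
  also have "\<dots> \<le> K * (\<Sum>j\<in>J. 1 / real N powr q) powr \<gamma>"
  proof (intro mult_left_mono powr_mono2 sum_mono K sum_nonneg)
    fix j assume "j \<in> J"
    then have "\<bar>real_of_int (x j - y j) / N\<bar> \<le> 1 / N"
      using assms[of j] N by (simp add: divide_right_mono flip: of_int_abs)
    then have "\<bar>real_of_int (x j - y j) / N\<bar> powr q \<le> (1 / N) powr q" using q by (intro powr_mono2) auto
    then show "\<bar>real_of_int (x j - y j) / N\<bar> powr q \<le> 1 / real N powr q" by (simp add: powr_divide)
  qed (use \<gamma> in auto)
  finally show ?thesis by (simp add: \<epsilon>_def)
qed

lemma box_le: "z \<in> box \<Longrightarrow> j \<in> J \<Longrightarrow> \<bar>z j\<bar> \<le> int N"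
  by (force simp: PiE_iff)

lemma G_Lp: "G x \<in> Lp_fun M p"
  using Lp_E(1)[of "\<lambda>z. F (\<lambda>i. x i + z i)" "\<lambda>_. 1"] F_Lp by (simp add: G_def[abs_def])

lemma Y_Lp: "Y j x \<in> Lp_fun M p"
  using Lp_E(1)[of "\<lambda>z. F (\<lambda>i. x i + z i)" "\<lambda>z. s (z j)"] F_Lp by (simp add: Y_def[abs_def])

lemma B_Lp: "B j x \<in> Lp_fun M p"
  unfolding B_def[abs_def]
  using Lp_fun_cmult(1)[OF p1 Lp_E(1)[of "\<lambda>z \<omega>. F (\<lambda>i. x i + (z(j := int N)) i) \<omega> - F (\<lambda>i. x i + (z(j := 0)) i) \<omega>" "\<lambda>_. 1"], of \<beta>]
    F_diff_Lp by simp

lemma mom_G_minus_F: "mom (\<lambda>\<omega>. G x \<omega> - F x \<omega>) \<le> K * real (card J) powr \<gamma>"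
proof -
  have eq: "(\<lambda>\<omega>. G x \<omega> - F x \<omega>) = (\<lambda>\<omega>. E (\<lambda>z. 1 * (F (\<lambda>i. x i + z i) \<omega> - F x \<omega>)))"
    by (simp add: G_def E_diff E_const)
  have "mom (\<lambda>\<omega>. G x \<omega> - F x \<omega>) \<le> 1 powr p * (K * real (card J) powr \<gamma>)"
    unfolding eq by (rule mom_E_le) (use K box_le in \<open>auto intro!: F_diff_Lp F_near simp: E_const\<close>)
  then show ?thesis by simp
qed

text \<open>Since the score has mean zero, one may subtract the value of \<open>F\<close> with
  \<open>z j\<close> set to 0. Then only the oscillation in the single coordinate \<open>j\<close>
  enters, and the bound does not depend on the dimension.\<close>

lemma mom_Y:
  assumes j: "j \<in> J"
  shows "mom (Y j x) \<le> (8 / N) powr p * K"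
proof -
  have "E (\<lambda>z. s (z j) * F (\<lambda>i. x i + (z(j := 0)) i) \<omega>) = 0" for \<omega>
    by (intro E_score_mult j scores) simp
  then have eq: "Y j x = (\<lambda>\<omega>. E (\<lambda>z. s (z j) * (F (\<lambda>i. x i + z i) \<omega> - F (\<lambda>i. x i + (z(j := 0)) i) \<omega>)))"
    by (intro ext) (simp add: Y_def right_diff_distrib E_diff)
  show ?thesis unfolding eq
  proof (rule mom_E_le)
    fix z assume "z \<in> box"
    then show "mom (\<lambda>\<omega>. F (\<lambda>i. x i + z i) \<omega> - F (\<lambda>i. x i + (z(j := 0)) i) \<omega>) \<le> K"
      using F_one_coordinate[OF j, of "z j" 0 x z] box_le[of z j] j by simp
  qed (use j in \<open>auto intro!: F_diff_Lp K E_abs_score\<close>)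
qed

lemma \<epsilon>_nonneg: "0 \<le> \<epsilon>" using K by (simp add: \<epsilon>_def)

lemma mom_Y_shift:
  assumes j: "j \<in> J" and v: "\<And>i. i \<in> J \<Longrightarrow> \<bar>x i - y i\<bar> \<le> 1"
  shows "mom (\<lambda>\<omega>. Y j x \<omega> - Y j y \<omega>) \<le> (8 / N) powr p * \<epsilon>"
proof -
  have eq: "(\<lambda>\<omega>. Y j x \<omega> - Y j y \<omega>) = (\<lambda>\<omega>. E (\<lambda>z. s (z j) * (F (\<lambda>i. x i + z i) \<omega> - F (\<lambda>i. y i + z i) \<omega>)))"
    by (intro ext) (simp add: Y_def right_diff_distrib E_diff)
  show ?thesis unfolding eq
    by (rule mom_E_le) (use j v in \<open>auto intro!: F_diff_Lp F_fine \<epsilon>_nonneg E_abs_score\<close>)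
qed

text \<open>The small mass \<open>\<beta>\<close> gives the boundary term order \<open>N^-3\<close>
  in norm, against \<open>N^-1\<close> for \<open>Y\<close>; summing over a multiple of
  \<open>N\<close> steps still leaves a vanishing error.\<close>

lemma mom_B:
  assumes j: "j \<in> J"
  shows "mom (B j x) \<le> (3 / real N ^ 3) powr p * K"
proof -
  let ?h = "\<lambda>z \<omega>. F (\<lambda>i. x i + (z(j := int N)) i) \<omega> - F (\<lambda>i. x i + (z(j := 0)) i) \<omega>"
  have eq: "B j x = (\<lambda>\<omega>. E (\<lambda>z. \<beta> * ?h z \<omega>))"
    by (intro ext) (simp only: B_def E_cmult)
  show ?thesis unfolding eq
    by (rule mom_E_le) (use \<beta> in \<open>auto intro!: F_diff_Lp F_one_coordinate j K simp: E_const simp del: fun_upd_apply\<close>)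
qed

end

section \<open>Random block directions\<close>

lemma sum_box_shift_le:
  fixes \<Phi> :: "('j \<Rightarrow> int) \<Rightarrow> real"
  assumes "finite J" and nonneg: "\<And>x. 0 \<le> \<Phi> x" and dep: "\<And>x. \<Phi> (restrict x J) = \<Phi> x"
    and v: "\<And>j. j \<in> J \<Longrightarrow> \<bar>v j\<bar> \<le> T"
  shows "(\<Sum>x\<in>PiE J (\<lambda>_. {0..<L}). \<Phi> (\<lambda>j. x j + v j)) \<le> (\<Sum>x\<in>PiE J (\<lambda>_. {-T..<L+T}). \<Phi> x)"
proof -
  \<comment> \<open>Translation leaves the extensional functions on \<open>J\<close>; restricting
    brings it back, and \<open>\<Phi>\<close> does not see the restriction.\<close>
  define sh where "sh = (\<lambda>x. restrict (\<lambda>j. x j + v j) J)"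
  have inj: "inj_on sh (PiE J (\<lambda>_. {0..<L}))"
  proof (rule inj_onI)
    fix x y assume xy: "x \<in> PiE J (\<lambda>_. {0..<L})" "y \<in> PiE J (\<lambda>_. {0..<L})" "sh x = sh y"
    have "x j = y j" if "j \<in> J" for j
      using fun_cong[OF xy(3), of j] that by (simp add: sh_def)
    then show "x = y" using xy by (intro PiE_ext) auto
  qed
  have "(\<Sum>x\<in>PiE J (\<lambda>_. {0..<L}). \<Phi> (\<lambda>j. x j + v j)) = (\<Sum>x\<in>sh ` PiE J (\<lambda>_. {0..<L}). \<Phi> x)"
    by (subst sum.reindex[OF inj]) (simp add: sh_def dep)
  also have "\<dots> \<le> (\<Sum>x\<in>PiE J (\<lambda>_. {-T..<L+T}). \<Phi> x)"
  proof (intro sum_mono2 nonneg finite_PiE assms(1))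
    show "sh ` PiE J (\<lambda>_. {0..<L}) \<subseteq> PiE J (\<lambda>_. {-T..<L+T})"
      using v by (fastforce simp: sh_def PiE_iff abs_le_iff)
  qed auto
  finally show ?thesis .
qed

lemma enlarged_box_le_twice:
  fixes T :: nat
  assumes "finite J"
  obtains L :: int where "L > 0"
    "real (card (PiE J (\<lambda>_. {-int T..<L + int T}))) \<le> 2 * real (card (PiE J (\<lambda>_. {0..<L})))"
proof -
  define n where "n = card J"
  \<comment> \<open>The side is chosen so that \<open>2 * T * n / L \<le> 1 / 2\<close>, whence the
    volume ratio is at most \<open>exp (1/2) \<le> 2\<close>. Adding 1 keeps \<open>L\<close>
    positive when \<open>T\<close> or \<open>n\<close> is 0.\<close>
  define L where "L = 4 * int T * int n + 1"
  have L: "L > 0" by (simp add: L_def)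
  have "(1 + 2 * real T / L) ^ n \<le> exp (2 * real T / L) ^ n"
    using L exp_ge_add_one_self[of "2 * real T / L"] by (intro power_mono) auto
  also have "\<dots> = exp (real n * (2 * real T / L))" by (simp only: exp_of_nat_mult)
  also have "\<dots> \<le> exp (1 / 2)"
  proof -
    have "real_of_int L = 4 * real T * real n + 1" by (simp add: L_def)
    then have "(2 * real T * real n) / L \<le> 1 / 2" using L by (simp add: pos_divide_le_eq)
    then show ?thesis by (simp add: mult_ac)
  qed
  also have "\<dots> \<le> 2"
  proof -
    have "exp (1 / 2 :: real) \<le> 1 + 1 / 2 + (1 / 2)\<^sup>2" by (rule exp_bound) auto
    also have "\<dots> \<le> 2" by (simp add: power2_eq_square)
    finally show ?thesis .
  qed
  finally have *: "(1 + 2 * real T / L) ^ n \<le> 2" .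
  have "real (card (PiE J (\<lambda>_. {-int T..<L + int T}))) = (L + 2 * real T) ^ n"
    using assms L by (simp add: card_PiE n_def algebra_simps)
  also have "\<dots> = real_of_int L ^ n * (1 + 2 * real T / L) ^ n"
  proof -
    have "L + 2 * real T = L * (1 + 2 * real T / L)" using L by (simp add: distrib_left)
    then show ?thesis by (simp only: power_mult_distrib)
  qed
  also have "\<dots> \<le> real_of_int L ^ n * 2"
    using * L by (intro mult_left_mono) auto
  also have "\<dots> = 2 * real (card (PiE J (\<lambda>_. {0..<L})))"
    using assms L by (simp add: card_PiE n_def)
  finally show ?thesis using that L by blast
qed

lemma base_powr_minus_one: "0 \<le> x \<Longrightarrow> x powr (p - 1) * x = x powr p" for x :: real
  using powr_mult_base[of x "p - 1"] by (simp add: mult.commute)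

text \<open>Coordinates come in \<open>k\<close> blocks of size \<open>\<tau>\<close>. Dependence of
  \<open>F\<close> on these coordinates only is what allows sums over boxes of base points to be
  translated.\<close>

locale block_lattice_map =
  lattice_map M p q \<gamma> K N "{..<k} \<times> {..<\<tau>}" F \<rho> s \<beta>
  for M :: "'w measure" and p q \<gamma> K :: real and N k \<tau> :: nat
    and F :: "(nat \<times> nat \<Rightarrow> int) \<Rightarrow> 'w \<Rightarrow> real" and \<rho> s :: "int \<Rightarrow> real" and \<beta> :: real +
  assumes \<tau>: "1 \<le> \<tau>"
    and F_restrict: "\<And>x. F (restrict x ({..<k} \<times> {..<\<tau>})) = F x"
begin

abbreviation J where "J \<equiv> {..<k} \<times> {..<\<tau>}"
abbreviation choices :: "(nat \<times> int) set" where "choices \<equiv> {..<\<tau>} \<times> {1, -1}"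
abbreviation dirs :: "(nat \<Rightarrow> nat \<times> int) set" where "dirs \<equiv> PiE {..<k} (\<lambda>_. choices)"

text \<open>\<open>\<alpha> b\<close> holds the position and the sign chosen in block
  \<open>b\<close>. Truncation to the first \<open>c\<close> blocks gives the intermediate points of
  a path from 0 to the full direction that moves one coordinate at a time.\<close>

definition partial_dir :: "(nat \<Rightarrow> nat \<times> int) \<Rightarrow> nat \<Rightarrow> nat \<times> nat \<Rightarrow> int" where
  "partial_dir \<alpha> c = (\<lambda>j. if fst j < c \<and> fst (\<alpha> (fst j)) = snd j then snd (\<alpha> (fst j)) else 0)"

abbreviation dir where "dir \<alpha> \<equiv> partial_dir \<alpha> k"

text \<open>The directional derivative of \<open>G\<close> with all partial derivatives taken at the
  same point \<open>x\<close>: for fixed \<open>x\<close> and \<open>\<omega>\<close> it is a sum of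
  independent symmetric variables in \<open>\<alpha>\<close>.\<close>

definition lin where "lin \<alpha> x \<omega> = (\<Sum>b<k. real_of_int (snd (\<alpha> b)) * Y (b, fst (\<alpha> b)) x \<omega>)"

lemma dirs_D:
  assumes "\<alpha> \<in> dirs" "b < k"
  shows "(b, fst (\<alpha> b)) \<in> J" "snd (\<alpha> b) = 1 \<or> snd (\<alpha> b) = -1"
proof -
  have "\<alpha> b \<in> choices" using PiE_mem[OF assms(1)] assms(2) by blast
  then show "(b, fst (\<alpha> b)) \<in> J" "snd (\<alpha> b) = 1 \<or> snd (\<alpha> b) = -1"
    using assms(2) by (auto simp: mem_Times_iff)
qed

lemma abs_partial_dir_le: "\<alpha> \<in> dirs \<Longrightarrow> c \<le> k \<Longrightarrow> \<bar>partial_dir \<alpha> c j\<bar> \<le> 1"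
proof (cases "fst j < c \<and> fst (\<alpha> (fst j)) = snd j")
  case True
  moreover assume "\<alpha> \<in> dirs" "c \<le> k"
  ultimately show ?thesis using dirs_D(2)[of \<alpha> "fst j"] by (simp add: partial_dir_def) linarith
next
  case False
  then have "partial_dir \<alpha> c j = 0" unfolding partial_dir_def by (rule if_not_P)
  then show ?thesis by simp
qed

lemma G_dir_step:
  assumes \<alpha>: "\<alpha> \<in> dirs"
  obtains u where "\<And>b j. b < k \<Longrightarrow> \<bar>u b j\<bar> \<le> 1"
    "\<And>x \<omega>. G (\<lambda>i. x i + dir \<alpha> i) \<omega> - G x \<omega>
      = (\<Sum>b<k. real_of_int (snd (\<alpha> b)) *
          (Y (b, fst (\<alpha> b)) (\<lambda>i. x i + u b i) \<omega> + B (b, fst (\<alpha> b)) (\<lambda>i. x i + u b i) \<omega>))"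
proof -
  \<comment> \<open>A negative unit step is a positive one read backwards, so its increment is based
    at the later of the two path points.\<close>
  define u where "u = (\<lambda>b. if snd (\<alpha> b) = 1 then partial_dir \<alpha> b else partial_dir \<alpha> (Suc b))"
  define g where "g = (\<lambda>x \<omega> c. G (\<lambda>i. x i + partial_dir \<alpha> c i) \<omega>)"
  have step: "g x \<omega> (Suc b) - g x \<omega> b = real_of_int (snd (\<alpha> b)) *
          (Y (b, fst (\<alpha> b)) (\<lambda>i. x i + u b i) \<omega> + B (b, fst (\<alpha> b)) (\<lambda>i. x i + u b i) \<omega>)"
    if b: "b < k" for b x \<omega>
  proof -
    define j where "j = (b, fst (\<alpha> b))"
    have j: "j \<in> J" using dirs_D(1)[OF \<alpha> b] by (simp add: j_def)
    have at: "partial_dir \<alpha> (Suc b) i = (if i = j then snd (\<alpha> b) else partial_dir \<alpha> b i)"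
         "partial_dir \<alpha> b j = 0" for i
      by (auto simp: partial_dir_def j_def less_Suc_eq prod_eq_iff)
    consider "snd (\<alpha> b) = 1" | "snd (\<alpha> b) = -1" using dirs_D(2)[OF \<alpha> b] by blast
    then show ?thesis
    proof cases
      case 1
      define x' where "x' = (\<lambda>i. x i + partial_dir \<alpha> b i)"
      have "(\<lambda>i. x i + partial_dir \<alpha> (Suc b) i) = x'(j := x' j + 1)"
        using 1 at by (auto simp: x'_def)
      then show ?thesis
        using G_step[OF j, of x' \<omega>] 1 by (simp add: g_def u_def x'_def j_def)
    next
      case 2
      define x' where "x' = (\<lambda>i. x i + partial_dir \<alpha> (Suc b) i)"
      have "(\<lambda>i. x i + partial_dir \<alpha> b i) = x'(j := x' j + 1)"
        using 2 at by (auto simp: x'_def)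
      then show ?thesis
        using G_step[OF j, of x' \<omega>] 2 by (simp add: g_def u_def x'_def j_def)
    qed
  qed
  show ?thesis
  proof (rule that[of u])
    fix b j assume "b < k"
    then show "\<bar>u b j\<bar> \<le> 1" using abs_partial_dir_le[OF \<alpha>, of _ j] by (simp add: u_def)
  next
    fix x \<omega>
    have "G (\<lambda>i. x i + dir \<alpha> i) \<omega> - G x \<omega> = g x \<omega> k - g x \<omega> 0"
      by (simp add: g_def partial_dir_def)
    also have "\<dots> = (\<Sum>b<k. g x \<omega> (Suc b) - g x \<omega> b)" by (rule sum_lessThan_telescope[symmetric])
    also have "\<dots> = (\<Sum>b<k. real_of_int (snd (\<alpha> b)) *
          (Y (b, fst (\<alpha> b)) (\<lambda>i. x i + u b i) \<omega> + B (b, fst (\<alpha> b)) (\<lambda>i. x i + u b i) \<omega>))"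
      by (intro sum.cong) (auto simp: step)
    finally show "G (\<lambda>i. x i + dir \<alpha> i) \<omega> - G x \<omega> = \<dots>" .
  qed
qed

text \<open>Error of one block in one lattice step: moving the base point of \<open>Y\<close> back
  to the common point, plus the boundary term.\<close>

definition \<delta> where "\<delta> = 2 powr (p - 1) * ((8 / N) powr p * \<epsilon> + (3 / real N ^ 3) powr p * K)"

lemma lin_Lp: "lin \<alpha> x \<in> Lp_fun M p"
  unfolding lin_def[abs_def] by (rule Lp_fun_lincomb(1)[OF p1 finite_lessThan Y_Lp])

lemma mom_G_long_step:
  assumes \<alpha>: "\<alpha> \<in> dirs"
  shows "mom (\<lambda>\<omega>. G (\<lambda>i. x i + int T * dir \<alpha> i) \<omega> - G x \<omega>)
    \<le> 2 powr (p - 1) * (real T powr (p - 1) * (\<Sum>t<T. mom (lin \<alpha> (\<lambda>i. x i + int t * dir \<alpha> i)))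
        + (real T * real k) powr p * \<delta>)"
proof -
  obtain u where u: "\<And>b j. b < k \<Longrightarrow> \<bar>u b j\<bar> \<le> 1"
    "\<And>x \<omega>. G (\<lambda>i. x i + dir \<alpha> i) \<omega> - G x \<omega>
      = (\<Sum>b<k. real_of_int (snd (\<alpha> b)) *
          (Y (b, fst (\<alpha> b)) (\<lambda>i. x i + u b i) \<omega> + B (b, fst (\<alpha> b)) (\<lambda>i. x i + u b i) \<omega>))"
    using G_dir_step[OF \<alpha>] by blast
  define X where "X = (\<lambda>t i. x i + int t * dir \<alpha> i)"
  \<comment> \<open>The part of a block increment not captured by \<open>lin\<close>.\<close>
  define r where "r = (\<lambda>t b \<omega>. real_of_int (snd (\<alpha> b)) *
    ((Y (b, fst (\<alpha> b)) (\<lambda>i. X t i + u b i) \<omega> - Y (b, fst (\<alpha> b)) (X t) \<omega>)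
      + B (b, fst (\<alpha> b)) (\<lambda>i. X t i + u b i) \<omega>))"
  have r: "r t b \<in> Lp_fun M p" "mom (r t b) \<le> \<delta>" if b: "b < k" for t b
  proof -
    let ?j = "(b, fst (\<alpha> b))"
    let ?d = "\<lambda>\<omega>. Y ?j (\<lambda>i. X t i + u b i) \<omega> - Y ?j (X t) \<omega>"
    let ?e = "\<lambda>\<omega>. ?d \<omega> + B ?j (\<lambda>i. X t i + u b i) \<omega>"
    have j: "?j \<in> J" by (rule dirs_D(1)[OF \<alpha> b])
    have d: "?d \<in> Lp_fun M p" by (intro Lp_fun_diff p1 Y_Lp)
    have e: "?e \<in> Lp_fun M p" by (intro Lp_fun_add p1 d B_Lp)
    show "r t b \<in> Lp_fun M p" unfolding r_def by (intro Lp_fun_cmult p1 e)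
    have "mom (r t b) = mom ?e"
      unfolding r_def using Lp_fun_cmult(2)[OF p1 e] dirs_D(2)[OF \<alpha> b] by auto
    also have "\<dots> \<le> 2 powr (p - 1) * (mom ?d + mom (B ?j (\<lambda>i. X t i + u b i)))"
      by (rule Lp_fun_add(2)[OF p1 d B_Lp])
    also have "\<dots> \<le> \<delta>"
      unfolding \<delta>_def by (intro mult_left_mono add_mono mom_Y_shift mom_B j) (use u(1) b in auto)
    finally show "mom (r t b) \<le> \<delta>" .
  qed
  define S where "S = (\<lambda>\<omega>. \<Sum>t<T. lin \<alpha> (X t) \<omega>)"
  define W where "W = (\<lambda>\<omega>. \<Sum>t<T. \<Sum>b<k. r t b \<omega>)"
  have "G (\<lambda>i. x i + int T * dir \<alpha> i) \<omega> - G x \<omega> = S \<omega> + W \<omega>" for \<omega>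
  proof -
    have "G (\<lambda>i. x i + int T * dir \<alpha> i) \<omega> - G x \<omega> = (\<Sum>t<T. G (X (Suc t)) \<omega> - G (X t) \<omega>)"
      by (subst sum_lessThan_telescope) (simp add: X_def)
    also have "\<dots> = (\<Sum>t<T. lin \<alpha> (X t) \<omega> + (\<Sum>b<k. r t b \<omega>))"
    proof (intro sum.cong refl)
      fix t
      have "X (Suc t) = (\<lambda>i. X t i + dir \<alpha> i)" by (auto simp: X_def algebra_simps)
      then show "G (X (Suc t)) \<omega> - G (X t) \<omega> = lin \<alpha> (X t) \<omega> + (\<Sum>b<k. r t b \<omega>)"
        by (simp add: u(2) lin_def r_def sum.distrib[symmetric] algebra_simps)
    qed
    finally show ?thesis by (simp add: S_def W_def sum.distrib)
  qed
  then have eq: "(\<lambda>\<omega>. G (\<lambda>i. x i + int T * dir \<alpha> i) \<omega> - G x \<omega>) = (\<lambda>\<omega>. S \<omega> + W \<omega>)" by blast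
  have S: "S \<in> Lp_fun M p" "mom S \<le> real T powr (p - 1) * (\<Sum>t<T. mom (lin \<alpha> (X t)))"
    unfolding S_def using Lp_fun_sum[OF p1, of "{..<T}" "\<lambda>t. lin \<alpha> (X t)"] lin_Lp by auto
  have rb: "(\<lambda>\<omega>. \<Sum>b<k. r t b \<omega>) \<in> Lp_fun M p" "mom (\<lambda>\<omega>. \<Sum>b<k. r t b \<omega>) \<le> real k powr p * \<delta>" for t
  proof -
    show "(\<lambda>\<omega>. \<Sum>b<k. r t b \<omega>) \<in> Lp_fun M p" by (intro Lp_fun_sum p1) (auto simp: r)
    have "mom (\<lambda>\<omega>. \<Sum>b<k. r t b \<omega>) \<le> real (card {..<k}) powr (p - 1) * (\<Sum>b<k. mom (r t b))"
      by (intro Lp_fun_sum p1) (auto simp: r)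
    also have "\<dots> \<le> real k powr (p - 1) * (\<Sum>b<k. \<delta>)"
      by (simp only: card_lessThan) (intro mult_left_mono sum_mono r, auto)
    also have "\<dots> = real k powr p * \<delta>" by (simp add: base_powr_minus_one mult.assoc[symmetric])
    finally show "mom (\<lambda>\<omega>. \<Sum>b<k. r t b \<omega>) \<le> real k powr p * \<delta>" .
  qed
  have W: "W \<in> Lp_fun M p" unfolding W_def by (rule Lp_fun_sum[OF p1]) (auto simp: rb)
  have "mom W \<le> real (card {..<T}) powr (p - 1) * (\<Sum>t<T. mom (\<lambda>\<omega>. \<Sum>b<k. r t b \<omega>))"
    unfolding W_def by (rule Lp_fun_sum[OF p1]) (auto simp: rb)
  also have "\<dots> \<le> real T powr (p - 1) * (\<Sum>t<T. real k powr p * \<delta>)"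
    by (simp only: card_lessThan) (intro mult_left_mono sum_mono rb, auto)
  also have "\<dots> = (real T * real k) powr p * \<delta>"
    by (simp add: base_powr_minus_one mult.assoc[symmetric] powr_mult)
  finally have W': "mom W \<le> (real T * real k) powr p * \<delta>" .
  have "mom (\<lambda>\<omega>. S \<omega> + W \<omega>) \<le> 2 powr (p - 1) * (mom S + mom W)"
    by (rule Lp_fun_add(2)[OF p1 S(1) W])
  also have "\<dots> \<le> 2 powr (p - 1) * (real T powr (p - 1) * (\<Sum>t<T. mom (lin \<alpha> (X t)))
        + (real T * real k) powr p * \<delta>)"
    by (intro mult_left_mono add_mono S(2) W') auto
  finally show ?thesis by (simp add: eq X_def)
qed

definition rc where "rc = exp (rosenthal_const p) * rosenthal_const p"

lemma rc_pos: "rc > 0" by (simp add: rc_def rosenthal_const_pos)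

text \<open>The two terms of Rosenthal's inequality: \<open>real k\<close> comes from the individual
  p-th moments, the other term from the variance through Bessel's inequality. The factor
  \<open>(8 / N) powr p\<close> reflects one lattice step.\<close>

definition U where "U = rc * K * (8 / N) powr p * (real k + real \<tau> powr (- p / 2) * real (k * \<tau>) powr \<gamma>)"

lemma U_nonneg: "0 \<le> U"
  unfolding U_def using less_imp_le[OF rc_pos] K by (intro mult_nonneg_nonneg add_nonneg_nonneg) simp_all

lemma card_dirs: "real (card dirs) = (2 * real \<tau>) ^ k" "real (card dirs) > 0"
proof -
  have "card choices = 2 * \<tau>" by (simp add: card_cartesian_product)
  then show "real (card dirs) = (2 * real \<tau>) ^ k" by (simp add: card_PiE)
  then show "real (card dirs) > 0" using \<tau> by simp
qed

text \<open>Rosenthal and Bessel are applied at each fixed \<open>\<omega>\<close>, where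
  \<open>lin\<close> is a real-valued random sum over the directions; only then is the result
  integrated and the modulus of \<open>F\<close> used.\<close>

lemma sum_mom_lin_le: "(\<Sum>\<alpha>\<in>dirs. mom (lin \<alpha> x)) \<le> real (card dirs) * U"
proof -
  define \<nu> :: "nat \<times> int \<Rightarrow> nat \<times> int" where "\<nu> = (\<lambda>(i, \<sigma>). (i, - \<sigma>))"
  define \<kappa> where "\<kappa> = 54 / real N ^ 2"
  have \<kappa>: "\<kappa> > 0" using N by (simp add: \<kappa>_def)
  \<comment> \<open>\<open>F x\<close> does not depend on \<open>z\<close>, so the score annihilates
    it and Bessel's inequality may be applied to the oscillation \<open>D\<close>.\<close>
  define D where "D = (\<lambda>z \<omega>. F (\<lambda>i. x i + z i) \<omega> - F x \<omega>)"
  have Y_eq: "Y j x \<omega> = E (\<lambda>z. s (z j) * D z \<omega>)" if "j \<in> J" for j \<omega>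
  proof -
    have "E (\<lambda>z. s (z j) * F x \<omega>) = 0" by (intro E_score_mult that scores refl)
    then show ?thesis by (simp add: D_def Y_def right_diff_distrib E_diff)
  qed
  define P where "P = (\<lambda>\<omega>. (\<kappa> / \<tau>) powr (p / 2) * E (\<lambda>z. \<bar>D z \<omega>\<bar> powr p) + (1 / \<tau>) * (\<Sum>j\<in>J. \<bar>Y j x \<omega>\<bar> powr p))"
  have point: "(\<Sum>\<alpha>\<in>dirs. \<bar>lin \<alpha> x \<omega>\<bar> powr p) \<le> real (card dirs) * (rc * P \<omega>)" for \<omega>
  proof -
    define y where "y = (\<lambda>b (a :: nat \<times> int). real_of_int (snd a) * Y (b, fst a) x \<omega>)"
    have \<nu>: "bij_betw \<nu> choices choices"
      by (rule bij_betw_byWitness[where f' = \<nu>]) (auto simp: \<nu>_def)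
    \<comment> \<open>Both signs give the same absolute value, so the mean over the
      \<open>2 * \<tau>\<close> choices is the mean over the \<open>\<tau>\<close>
      positions.\<close>
    have choices_sum: "(\<Sum>a\<in>choices. h (\<bar>y b a\<bar>)) / card choices = (\<Sum>i<\<tau>. h \<bar>Y (b, i) x \<omega>\<bar>) / \<tau>" for h :: "real \<Rightarrow> real" and b
    proof -
      have "(\<Sum>a\<in>choices. h (\<bar>y b a\<bar>)) = (\<Sum>i<\<tau>. \<Sum>\<sigma>\<in>{1,-1::int}. h \<bar>y b (i, \<sigma>)\<bar>)"
        by (subst sum.cartesian_product) simp
      also have "\<dots> = (\<Sum>i<\<tau>. 2 * h \<bar>Y (b, i) x \<omega>\<bar>)" by (simp add: y_def)
      finally show ?thesis using \<tau> by (simp add: card_cartesian_product sum_distrib_left[symmetric])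
    qed
    have J_sum: "(\<Sum>b<k. (\<Sum>i<\<tau>. h (b, i)) / \<tau>) = (1 / \<tau>) * (\<Sum>j\<in>J. h j)" for h :: "nat \<times> nat \<Rightarrow> real"
      by (simp add: sum.cartesian_product sum_divide_distrib[symmetric])
    have "(\<Sum>\<alpha>\<in>dirs. \<bar>\<Sum>b<k. y b (\<alpha> b)\<bar> powr p) / card choices ^ k
      \<le> rc * ((\<Sum>b<k. (\<Sum>a\<in>choices. (y b a)\<^sup>2) / card choices) powr (p / 2)
          + (\<Sum>b<k. (\<Sum>a\<in>choices. \<bar>y b a\<bar> powr p) / card choices))"
      unfolding rc_def by (rule rosenthal_symmetric[OF p _ _ \<nu>]) (use \<tau> in \<open>auto simp: y_def \<nu>_def lessThan_empty_iff\<close>)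
    also have "(\<Sum>b<k. (\<Sum>a\<in>choices. (y b a)\<^sup>2) / card choices) = (1 / \<tau>) * (\<Sum>j\<in>J. (Y j x \<omega>)\<^sup>2)"
      using choices_sum[of "\<lambda>t. t\<^sup>2"] J_sum[of "\<lambda>j. (Y j x \<omega>)\<^sup>2"] by simp
    also have "(\<Sum>b<k. (\<Sum>a\<in>choices. \<bar>y b a\<bar> powr p) / card choices) = (1 / \<tau>) * (\<Sum>j\<in>J. \<bar>Y j x \<omega>\<bar> powr p)"
      using choices_sum[of "\<lambda>t. t powr p"] J_sum[of "\<lambda>j. \<bar>Y j x \<omega>\<bar> powr p"] by simp
    also have "((1 / \<tau>) * (\<Sum>j\<in>J. (Y j x \<omega>)\<^sup>2)) powr (p / 2) \<le> (\<kappa> / \<tau>) powr (p / 2) * E (\<lambda>z. \<bar>D z \<omega>\<bar> powr p)"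
    proof -
      have "(\<Sum>j\<in>J. (Y j x \<omega>)\<^sup>2) \<le> \<kappa> * E (\<lambda>z. (D z \<omega>)\<^sup>2)"
        using bessel_scores[OF scores(1) scores(2)[folded \<kappa>_def] \<kappa>, of "\<lambda>z. D z \<omega>"] by (simp add: Y_eq)
      then have "(1 / \<tau>) * (\<Sum>j\<in>J. (Y j x \<omega>)\<^sup>2) \<le> (\<kappa> / \<tau>) * E (\<lambda>z. (D z \<omega>)\<^sup>2)"
        by (simp add: divide_right_mono)
      then have "((1 / \<tau>) * (\<Sum>j\<in>J. (Y j x \<omega>)\<^sup>2)) powr (p / 2) \<le> ((\<kappa> / \<tau>) * E (\<lambda>z. (D z \<omega>)\<^sup>2)) powr (p / 2)"
        using p by (intro powr_mono2) (auto intro!: divide_nonneg_nonneg sum_nonneg)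
      also have "\<dots> = (\<kappa> / \<tau>) powr (p / 2) * (E (\<lambda>z. (D z \<omega>)\<^sup>2)) powr (p / 2)"
        by (rule powr_mult)
      also have "(E (\<lambda>z. (D z \<omega>)\<^sup>2)) powr (p / 2) \<le> E (\<lambda>z. \<bar>D z \<omega>\<bar> powr p)"
      proof -
        have nn: "0 \<le> E (\<lambda>z. (D z \<omega>)\<^sup>2)" by (intro E_nonneg) auto
        have "\<bar>(D z \<omega>)\<^sup>2\<bar> powr (p / 2) = \<bar>D z \<omega>\<bar> powr p" for z
        proof -
          have "\<bar>(D z \<omega>)\<^sup>2\<bar> = \<bar>D z \<omega>\<bar> powr 2" by simp
          then show ?thesis by (simp only: powr_powr) simp
        qed
        then show ?thesis using E_powr_le[of "p / 2" "\<lambda>z. (D z \<omega>)\<^sup>2"] p nn by simp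
      qed
      finally show ?thesis by (simp add: mult_left_mono)
    qed
    finally have "(\<Sum>\<alpha>\<in>dirs. \<bar>\<Sum>b<k. y b (\<alpha> b)\<bar> powr p) / card choices ^ k \<le> rc * P \<omega>"
      using rc_pos by (simp add: P_def mult_left_mono)
    then show ?thesis
      using card_dirs by (simp add: card_cartesian_product y_def lin_def pos_divide_le_eq mult.commute)
  qed
  have D_Lp: "D z \<in> Lp_fun M p" for z unfolding D_def by (rule F_diff_Lp)
  have int: "integrable M (\<lambda>\<omega>. \<bar>h \<omega>\<bar> powr p)" if "h \<in> Lp_fun M p" for h using that by (simp add: Lp_fun_def)
  have iE: "integrable M (\<lambda>\<omega>. E (\<lambda>z. \<bar>D z \<omega>\<bar> powr p))"
    unfolding expect_def by (intro Bochner_Integration.integrable_sum integrable_mult_right int D_Lp)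
  have iY: "integrable M (\<lambda>\<omega>. \<Sum>j\<in>J. \<bar>Y j x \<omega>\<bar> powr p)"
    by (intro Bochner_Integration.integrable_sum int Y_Lp)
  have iP: "integrable M P"
    unfolding P_def by (intro Bochner_Integration.integrable_add integrable_mult_right iE iY)
  have "(\<Sum>\<alpha>\<in>dirs. mom (lin \<alpha> x)) = (\<integral>\<omega>. (\<Sum>\<alpha>\<in>dirs. \<bar>lin \<alpha> x \<omega>\<bar> powr p) \<partial>M)"
    unfolding moment_def by (subst Bochner_Integration.integral_sum) (auto intro!: int lin_Lp)
  also have "\<dots> \<le> (\<integral>\<omega>. real (card dirs) * (rc * P \<omega>) \<partial>M)"
    by (intro integral_mono Bochner_Integration.integrable_sum int lin_Lp integrable_mult_right iP point)
  also have "\<dots> = real (card dirs) * (rc * (\<integral>\<omega>. P \<omega> \<partial>M))" by simp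
  also have "(\<integral>\<omega>. P \<omega> \<partial>M) = (\<kappa> / \<tau>) powr (p / 2) * E (\<lambda>z. mom (D z)) + (1 / \<tau>) * (\<Sum>j\<in>J. mom (Y j x))"
  proof -
    have "(\<integral>\<omega>. E (\<lambda>z. \<bar>D z \<omega>\<bar> powr p) \<partial>M) = E (\<lambda>z. mom (D z))"
      unfolding expect_def moment_def
      by (subst Bochner_Integration.integral_sum) (auto intro!: integrable_mult_right int D_Lp)
    moreover have "(\<integral>\<omega>. (\<Sum>j\<in>J. \<bar>Y j x \<omega>\<bar> powr p) \<partial>M) = (\<Sum>j\<in>J. mom (Y j x))"
      unfolding moment_def by (subst Bochner_Integration.integral_sum) (auto intro!: int Y_Lp)
    ultimately show ?thesis
      unfolding P_def using iE iY by (subst Bochner_Integration.integral_add) auto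
  qed
  also have "\<dots> \<le> ((8 / N) powr p * real \<tau> powr (- p / 2)) * (K * real (card J) powr \<gamma>)
      + (1 / \<tau>) * (\<Sum>j\<in>J. (8 / N) powr p * K)"
  proof (intro add_mono mult_mono sum_mono mom_Y)
    \<comment> \<open>Relaxing 54 to \<open>8^2\<close> gives the variance term the same factor
      \<open>(8 / N) powr p\<close> as the individual moments.\<close>
    have "(\<kappa> / \<tau>) powr (p / 2) \<le> ((8 / N)\<^sup>2 / \<tau>) powr (p / 2)"
      using p by (intro powr_mono2 divide_right_mono) (auto simp: \<kappa>_def power_divide divide_right_mono)
    also have "\<dots> = ((8 / N)\<^sup>2) powr (p / 2) * real \<tau> powr (- p / 2)"
      by (simp add: powr_divide powr_minus_divide)
    also have "((8 / N)\<^sup>2) powr (p / 2) = (8 / N) powr p"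
    proof -
      have "((8 / real N)\<^sup>2) = (8 / real N) powr 2" using N by simp
      then show ?thesis by (simp only: powr_powr) simp
    qed
    finally show "(\<kappa> / \<tau>) powr (p / 2) \<le> (8 / N) powr p * real \<tau> powr (- p / 2)" .
    have "E (\<lambda>z. mom (D z)) \<le> E (\<lambda>z. K * real (card J) powr \<gamma>)"
      unfolding D_def by (intro E_mono F_near) (use box_le in auto)
    then show "E (\<lambda>z. mom (D z)) \<le> K * real (card J) powr \<gamma>" by (simp add: E_const)
    show "0 \<le> E (\<lambda>z. mom (D z))" by (intro E_nonneg moment_nonneg)
  qed (auto intro!: sum_nonneg moment_nonneg)
  also have "\<dots> = K * (8 / N) powr p * (real k + real \<tau> powr (- p / 2) * real (k * \<tau>) powr \<gamma>)"
    using \<tau> by (simp add: card_cartesian_product algebra_simps)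
  finally have "(\<Sum>\<alpha>\<in>dirs. mom (lin \<alpha> x))
      \<le> real (card dirs) * (rc * (K * (8 / N) powr p * (real k + real \<tau> powr (- p / 2) * real (k * \<tau>) powr \<gamma>)))"
    using rc_pos by (simp add: mult_left_mono)
  then show ?thesis by (simp add: U_def mult.assoc)
qed

lemma lin_restrict: "lin \<alpha> (restrict x J) = lin \<alpha> x"
proof -
  have "F (\<lambda>i. restrict x J i + z i) = F (\<lambda>i. x i + z i)" for z
    by (subst (1 2) F_restrict[symmetric]) (rule arg_cong[of _ _ F], auto)
  then show ?thesis by (intro ext) (simp add: lin_def Y_def)
qed

text \<open>Along a segment the base point depends on the direction, so the bound for a fixed point
  does not apply directly. Summing over starting points in a large box removes this dependence:
  every translate lies in an enlarged box with at most twice as many points.\<close>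

lemma average_long_step:
  assumes low: "\<And>\<alpha> x. \<alpha> \<in> dirs \<Longrightarrow> Lb \<le> mom (\<lambda>\<omega>. G (\<lambda>i. x i + int T * dir \<alpha> i) \<omega> - G x \<omega>)"
  shows "Lb \<le> 2 powr (p - 1) * (2 * real T powr p * U + (real T * real k) powr p * \<delta>)"
proof -
  obtain L :: int where L: "L > 0"
    "real (card (PiE J (\<lambda>_. {-int T..<L + int T}))) \<le> 2 * real (card (PiE J (\<lambda>_. {0..<L})))"
    using enlarged_box_le_twice[of J T] by auto
  define X where "X = PiE J (\<lambda>_. {0..<L})"
  define X' where "X' = PiE J (\<lambda>_. {-int T..<L + int T})"
  define e where "e = (real T * real k) powr p * \<delta>"
  have X: "real (card X) > 0" "real (card X') \<le> 2 * real (card X)"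
    using L by (auto simp: X_def X'_def card_PiE)
  have "real (card dirs) * real (card X) * Lb = (\<Sum>\<alpha>\<in>dirs. \<Sum>x\<in>X. Lb)" by simp
  also have "\<dots> \<le> (\<Sum>\<alpha>\<in>dirs. \<Sum>x\<in>X. 2 powr (p - 1) * (real T powr (p - 1) *
      (\<Sum>t<T. mom (lin \<alpha> (\<lambda>i. x i + int t * dir \<alpha> i))) + e))"
    unfolding e_def by (intro sum_mono order_trans[OF low mom_G_long_step])
  also have "\<dots> = 2 powr (p - 1) * (real T powr (p - 1) *
      (\<Sum>\<alpha>\<in>dirs. \<Sum>x\<in>X. \<Sum>t<T. mom (lin \<alpha> (\<lambda>i. x i + int t * dir \<alpha> i))) + real (card dirs) * real (card X) * e)"
    by (simp add: sum_distrib_left[symmetric] sum.distrib distrib_left mult.assoc)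
  also have "\<dots> \<le> 2 powr (p - 1) * (real T powr (p - 1) *
      (T * (2 * real (card X) * (real (card dirs) * U))) + real (card dirs) * real (card X) * e)"
  proof (intro mult_left_mono add_right_mono)
    have "(\<Sum>\<alpha>\<in>dirs. \<Sum>x\<in>X. \<Sum>t<T. mom (lin \<alpha> (\<lambda>i. x i + int t * dir \<alpha> i)))
        = (\<Sum>t<T. \<Sum>\<alpha>\<in>dirs. \<Sum>x\<in>X. mom (lin \<alpha> (\<lambda>i. x i + int t * dir \<alpha> i)))"
      by (simp add: sum.swap[of _ "{..<T}" X] sum.swap[of _ "{..<T}" dirs])
    also have "\<dots> \<le> (\<Sum>t<T. \<Sum>\<alpha>\<in>dirs. \<Sum>x\<in>X'. mom (lin \<alpha> x))"
    proof (intro sum_mono)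
      fix t \<alpha> assume "t \<in> {..<T}" "\<alpha> \<in> dirs"
      then have v: "\<bar>int t * dir \<alpha> j\<bar> \<le> int T" for j
        using abs_partial_dir_le[of \<alpha> k j] mult_mono[of "int t" "int T" "\<bar>dir \<alpha> j\<bar>" 1] by (simp add: abs_mult)
      show "(\<Sum>x\<in>X. mom (lin \<alpha> (\<lambda>i. x i + int t * dir \<alpha> i))) \<le> (\<Sum>x\<in>X'. mom (lin \<alpha> x))"
        unfolding X_def X'_def
        by (rule sum_box_shift_le[where \<Phi> = "\<lambda>x. mom (lin \<alpha> x)"]) (use v in \<open>auto simp: moment_nonneg lin_restrict\<close>)
    qed
    \<comment> \<open>The base points now range over a set independent of \<open>\<alpha>\<close>,
      so the sum over directions can be taken first.\<close>
    also have "\<dots> = (\<Sum>t<T. \<Sum>x\<in>X'. \<Sum>\<alpha>\<in>dirs. mom (lin \<alpha> x))"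
      by (intro sum.cong refl sum.swap)
    also have "\<dots> \<le> (\<Sum>t<T. \<Sum>x\<in>X'. real (card dirs) * U)"
      by (intro sum_mono sum_mom_lin_le)
    also have "\<dots> = T * (real (card X') * (real (card dirs) * U))" by simp
    also have "\<dots> \<le> T * (2 * real (card X) * (real (card dirs) * U))"
      using X U_nonneg by (intro mult_left_mono mult_right_mono) auto
    finally show "(\<Sum>\<alpha>\<in>dirs. \<Sum>x\<in>X. \<Sum>t<T. mom (lin \<alpha> (\<lambda>i. x i + int t * dir \<alpha> i)))
        \<le> T * (2 * real (card X) * (real (card dirs) * U))" .
  qed auto
  also have "real T powr (p - 1) * (T * (2 * real (card X) * (real (card dirs) * U)))
      = real (card dirs) * real (card X) * (2 * real T powr p * U)"
    by (simp add: mult.assoc[symmetric] base_powr_minus_one)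
  finally have le: "real (card dirs) * real (card X) * Lb
      \<le> real (card dirs) * real (card X) * (2 powr (p - 1) * (2 * real T powr p * U + e))"
    by (simp add: algebra_simps)
  have "0 < real (card dirs) * real (card X)" using X card_dirs by (intro mult_pos_pos)
  then show ?thesis using le unfolding e_def by (simp only: mult_le_cancel_left_pos)
qed

text \<open>The increment of \<open>F\<close> is that of \<open>G\<close> plus the mollification
  errors at the two endpoints; three summands give the factor \<open>3 powr (p - 1)\<close>.\<close>

lemma long_step_le:
  assumes low: "\<And>\<alpha> x. \<alpha> \<in> dirs \<Longrightarrow> Lb \<le> mom (\<lambda>\<omega>. F (\<lambda>i. x i + int T * dir \<alpha> i) \<omega> - F x \<omega>)"
  shows "Lb \<le> 3 powr (p - 1) * (2 * K * real (k * \<tau>) powr \<gamma>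
    + 2 powr (p - 1) * (2 * real T powr p * U + (real T * real k) powr p * \<delta>))"
proof -
  define \<eta> where "\<eta> = K * real (k * \<tau>) powr \<gamma>"
  define c where "c = (3::real) powr (p - 1)"
  have c: "c > 0" by (simp add: c_def)
  have "Lb / c - 2 * \<eta> \<le> mom (\<lambda>\<omega>. G (\<lambda>i. x i + int T * dir \<alpha> i) \<omega> - G x \<omega>)" if "\<alpha> \<in> dirs" for \<alpha> x
  proof -
    define x' where "x' = (\<lambda>i. x i + int T * dir \<alpha> i)"
    define h where "h = (\<lambda>i::nat. if i = 0 then (\<lambda>\<omega>. - 1 * (G x' \<omega> - F x' \<omega>)) else if i = 1 then (\<lambda>\<omega>. G x' \<omega> - G x \<omega>) else (\<lambda>\<omega>. G x \<omega> - F x \<omega>))"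
    have GF: "(\<lambda>\<omega>. G y \<omega> - F y \<omega>) \<in> Lp_fun M p" for y by (intro Lp_fun_diff p1 G_Lp F_Lp)
    have h: "h i \<in> Lp_fun M p" for i
      unfolding h_def using GF by (auto intro!: Lp_fun_diff Lp_fun_cmult p1 G_Lp F_Lp simp del: mult_minus1)
    have m0: "mom (h 0) = mom (\<lambda>\<omega>. G x' \<omega> - F x' \<omega>)"
      unfolding h_def using Lp_fun_cmult(2)[OF p1 GF[of x'], of "-1"] by simp
    have "Lb \<le> mom (\<lambda>\<omega>. F x' \<omega> - F x \<omega>)" using low[OF that] by (simp add: x'_def)
    also have "(\<lambda>\<omega>. F x' \<omega> - F x \<omega>) = (\<lambda>\<omega>. \<Sum>i<3. h i \<omega>)"
      by (simp add: h_def eval_nat_numeral)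
    also have "mom \<dots> \<le> real (card {..<3::nat}) powr (p - 1) * (\<Sum>i<3. mom (h i))"
      by (intro Lp_fun_sum p1 h) auto
    also have "(\<Sum>i<3. mom (h i)) = mom (h 0) + mom (h 1) + mom (h 2)"
      by (simp add: eval_nat_numeral)
    also have "mom (h 0) \<le> \<eta>" unfolding m0 using mom_G_minus_F[of x'] by (simp add: \<eta>_def card_cartesian_product)
    also have "mom (h 2) \<le> \<eta>" using mom_G_minus_F[of x] by (simp add: \<eta>_def h_def card_cartesian_product)
    finally have "Lb \<le> c * (\<eta> + mom (h 1) + \<eta>)" by (simp add: c_def mult_left_mono)
    then have "Lb / c \<le> \<eta> + mom (h 1) + \<eta>" using c by (simp add: pos_divide_le_eq mult.commute)
    then show ?thesis by (simp add: h_def x'_def)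
  qed
  then have "Lb / c - 2 * \<eta> \<le> 2 powr (p - 1) * (2 * real T powr p * U + (real T * real k) powr p * \<delta>)"
    by (rule average_long_step)
  then have "Lb / c \<le> 2 * \<eta> + 2 powr (p - 1) * (2 * real T powr p * U + (real T * real k) powr p * \<delta>)"
    by simp
  then show ?thesis using c by (simp add: pos_divide_le_eq \<eta>_def c_def[symmetric] mult_ac)
qed

end

section \<open>Step functions, exponents and the quadratic\<close>

lemma sum_disjoint_indicators_powr:
  fixes c :: "'i \<Rightarrow> real"
  assumes "finite A" "disjoint_family_on I A" "0 < q"
  shows "\<bar>\<Sum>i\<in>A. c i * indicator (I i) t\<bar> powr q = (\<Sum>i\<in>A. \<bar>c i\<bar> powr q * indicator (I i) t)"
proof (cases "\<exists>i\<in>A. t \<in> I i")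
  case True
  then obtain l where l: "l \<in> A" "t \<in> I l" by blast
  then have *: "indicator (I i) t = (if i = l then 1 else (0::real))" if "i \<in> A" for i
    using that assms(2) by (auto simp: disjoint_family_on_def indicator_def)
  have "(\<Sum>i\<in>A. g i * indicator (I i) t) = g l" for g :: "'i \<Rightarrow> real"
  proof -
    have "(\<Sum>i\<in>A. g i * indicator (I i) t) = (\<Sum>i\<in>A. if i = l then g i else 0)"
      by (intro sum.cong) (auto simp: *)
    then show ?thesis using l assms(1) by simp
  qed
  then show ?thesis by simp
next
  case False
  then have "indicator (I i) t = (0::real)" if "i \<in> A" for i using that by auto
  then show ?thesis using assms by simp
qed

text \<open>The factor \<open>n powr (1 / q)\<close> compensates for the interval length
  \<open>1 / n\<close>, which makes the map from ell_q^n into L_q isometric.\<close>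

definition step_fun :: "real \<Rightarrow> nat \<Rightarrow> (nat \<Rightarrow> real) \<Rightarrow> real \<Rightarrow> real" where
  "step_fun q n c t = (\<Sum>i<n. (real n powr (1 / q) * c i) * indicator {real i / n..<real (Suc i) / n} t)"

lemma disjoint_unit_steps:
  fixes n :: nat
  shows "disjoint_family_on (\<lambda>i. {real i / n..<real (Suc i) / n}) A"
proof -
  have "i = j" if "real i / n \<le> t" "t < real (Suc i) / n" "real j / n \<le> t" "t < real (Suc j) / n" for i j t
  proof -
    \<comment> \<open>For \<open>n = 0\<close> division by zero yields 0 and all the intervals are
      empty.\<close>
    have n: "real n > 0" using that by (cases "n = 0") auto
    have "real i / n < real (Suc j) / n" "real j / n < real (Suc i) / n" using that by linarith+
    then have "real i < real (Suc j)" "real j < real (Suc i)" using n by (simp_all add: divide_less_cancel)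
    then show ?thesis by linarith
  qed
  then show ?thesis
    unfolding disjoint_family_on_def disjoint_iff atLeastLessThan_iff by metis
qed

lemma step_fun_moment:
  assumes "0 < q" "1 \<le> n"
  shows "step_fun q n c \<in> Lp_fun (lebesgue_on {0..1}) q"
    and "moment (lebesgue_on {0..1}) q (step_fun q n c) = (\<Sum>i<n. \<bar>c i\<bar> powr q)"
proof -
  let ?I = "\<lambda>i. {real i / n..<real (Suc i) / n}"
  let ?M = "lebesgue_on {0..1::real}"
  have sub: "?I i \<subseteq> {0..1}" if "i < n" for i
  proof -
    have "real (Suc i) / n \<le> 1" using that assms by (simp add: divide_le_eq_1)
    moreover have "0 \<le> real i / n" by simp
    ultimately show ?thesis unfolding subset_eq Ball_def atLeastLessThan_iff atLeastAtMost_iff by linarith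
  qed
  have sets: "?I i \<in> sets ?M" if "i < n" for i
    using sub[OF that] by (subst sets_restrict_space_iff) auto
  have emeas: "emeasure ?M (?I i) = ennreal (1 / n)" if "i < n" for i
  proof -
    have "emeasure ?M (?I i) = emeasure lebesgue (?I i)"
      by (intro emeasure_restrict_space) (use sub[OF that] in auto)
    also have "\<dots> = emeasure lborel (?I i)" by simp
    also have "\<dots> = ennreal (real (Suc i) / n - real i / n)"
      by (rule emeasure_lborel_Ico) (simp add: divide_right_mono)
    finally show ?thesis by (simp add: diff_divide_distrib[symmetric])
  qed
  have powr: "\<bar>step_fun q n c t\<bar> powr q = (\<Sum>i<n. (n * \<bar>c i\<bar> powr q) * indicator (?I i) t)" for t
  proof -
    have "\<bar>real n powr (1 / q) * c i\<bar> powr q = n * \<bar>c i\<bar> powr q" for i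
      using assms by (simp add: abs_mult powr_mult powr_powr)
    then show ?thesis
      unfolding step_fun_def
      by (subst sum_disjoint_indicators_powr[OF _ disjoint_unit_steps assms(1)]) auto
  qed
  have ind: "integrable ?M (indicator (?I i) :: real \<Rightarrow> real)" if "i < n" for i
    using sets[OF that] emeas[OF that] by (intro integrable_real_indicator) auto
  have "step_fun q n c \<in> borel_measurable ?M"
    unfolding step_fun_def[abs_def] using sets by (intro borel_measurable_sum borel_measurable_times) auto
  moreover have "integrable ?M (\<lambda>t. \<bar>step_fun q n c t\<bar> powr q)"
    unfolding powr using ind by (intro Bochner_Integration.integrable_sum integrable_mult_right) auto
  ultimately show "step_fun q n c \<in> Lp_fun ?M q" by (simp add: Lp_fun_def)
  have "moment ?M q (step_fun q n c) = (\<Sum>i<n. \<integral>t. (n * \<bar>c i\<bar> powr q) * indicator (?I i) t \<partial>?M)"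
    unfolding moment_def powr using ind by (intro Bochner_Integration.integral_sum integrable_mult_right) auto
  also have "\<dots> = (\<Sum>i<n. (n * \<bar>c i\<bar> powr q) * (1 / n))"
  proof (intro sum.cong refl)
    fix i assume "i \<in> {..<n}"
    then have i: "i < n" by simp
    have "measure ?M (?I i) = 1 / n" using emeas[OF i] by (simp add: measure_def)
    moreover have "(\<integral>t. indicator (?I i) t \<partial>?M) = measure ?M (?I i)"
      using sets[OF i] sets.sets_into_space[OF sets[OF i]] by (simp add: Int_absorb2)
    ultimately show "(\<integral>t. (n * \<bar>c i\<bar> powr q) * indicator (?I i) t \<partial>?M) = (n * \<bar>c i\<bar> powr q) * (1 / n)"
      by simp
  qed
  also have "\<dots> = (\<Sum>i<n. \<bar>c i\<bar> powr q)" using assms by simp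
  finally show "moment ?M q (step_fun q n c) = (\<Sum>i<n. \<bar>c i\<bar> powr q)" .
qed

lemma Lp_space_eq: "Lp_space p = Lp_fun (lebesgue_on {0..1}) p"
  by (simp add: Lp_space_def Lp_fun_def)

lemma Lp_dist_step_fun:
  assumes "0 < q" "1 \<le> n"
  shows "Lp_dist q (step_fun q n c) (step_fun q n d) = (\<Sum>i<n. \<bar>c i - d i\<bar> powr q) powr (1 / q)"
proof -
  have "(\<lambda>t. step_fun q n c t - step_fun q n d t) = step_fun q n (\<lambda>i. c i - d i)"
    by (intro ext) (simp add: step_fun_def sum_subtractf[symmetric] algebra_simps)
  then show ?thesis
    using step_fun_moment(2)[OF assms, of "\<lambda>i. c i - d i"]
    by (simp add: Lp_dist_def Lp_norm_def moment_def)
qed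

lemma moment_eq_Lp_dist:
  assumes "0 < p"
  shows "moment (lebesgue_on {0..1}) p (\<lambda>t. f t - g t) = Lp_dist p f g powr p"
proof -
  have "Lp_dist p f g powr p = moment (lebesgue_on {0..1}) p (\<lambda>t. f t - g t) powr 1"
    using assms by (simp add: Lp_dist_def Lp_norm_def moment_def powr_powr)
  then show ?thesis by (simp add: moment_nonneg)
qed

text \<open>Divide by \<open>k powr \<gamma>\<close> and let \<open>k\<close> tend to infinity: the
  summand \<open>real k\<close> disappears because \<open>\<gamma> > 1\<close>. Then take
  \<open>m\<close> about \<open>a * \<tau> powr (1 / q)\<close> and let \<open>\<tau>\<close> tend
  to infinity: as \<open>q > 2\<close>, the term with \<open>m powr p\<close> disappears too. What
  remains bounds every power \<open>a powr (q * \<gamma>)\<close> by \<open>C\<close>.\<close>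

lemma scale_inequality_exponent:
  fixes p q \<gamma> C :: real
  assumes p: "0 < p" and q: "2 < q" and "1 < \<gamma>"
  shows "\<not> (\<forall>k \<tau> m. 1 \<le> k \<longrightarrow> 1 \<le> \<tau> \<longrightarrow> 1 \<le> m \<longrightarrow> (real k * real m powr q) powr \<gamma>
    \<le> C * (real (k * \<tau>) powr \<gamma> + real m powr p * (real k + real \<tau> powr (- p / 2) * real (k * \<tau>) powr \<gamma>)))"
proof
  assume *: "\<forall>k \<tau> m. 1 \<le> k \<longrightarrow> 1 \<le> \<tau> \<longrightarrow> 1 \<le> m \<longrightarrow> (real k * real m powr q) powr \<gamma>
    \<le> C * (real (k * \<tau>) powr \<gamma> + real m powr p * (real k + real \<tau> powr (- p / 2) * real (k * \<tau>) powr \<gamma>))"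
  have A1: "real m powr (q * \<gamma>) \<le> C * (real \<tau> powr \<gamma> + real m powr p * (real \<tau> powr (- p / 2) * real \<tau> powr \<gamma>))"
    if "1 \<le> \<tau>" "1 \<le> m" for \<tau> m :: nat
  proof (rule LIMSEQ_le_const)
    have "(\<lambda>k. real k powr (1 - \<gamma>)) \<longlonglongrightarrow> 0"
      using assms by (intro tendsto_neg_powr filterlim_real_sequentially) auto
    then have "(\<lambda>k. C * (real \<tau> powr \<gamma> + real m powr p * (real k powr (1 - \<gamma>) + real \<tau> powr (- p / 2) * real \<tau> powr \<gamma>)))
        \<longlonglongrightarrow> C * (real \<tau> powr \<gamma> + real m powr p * (0 + real \<tau> powr (- p / 2) * real \<tau> powr \<gamma>))"
      by (intro tendsto_intros)
    then show "(\<lambda>k. C * (real \<tau> powr \<gamma> + real m powr p * (real k powr (1 - \<gamma>) + real \<tau> powr (- p / 2) * real \<tau> powr \<gamma>)))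
        \<longlonglongrightarrow> C * (real \<tau> powr \<gamma> + real m powr p * (real \<tau> powr (- p / 2) * real \<tau> powr \<gamma>))"
      by simp
    show "\<exists>k0. \<forall>k\<ge>k0. real m powr (q * \<gamma>) \<le> C * (real \<tau> powr \<gamma> + real m powr p * (real k powr (1 - \<gamma>) + real \<tau> powr (- p / 2) * real \<tau> powr \<gamma>))"
    proof (intro exI allI impI)
      fix k :: nat assume "1 \<le> k"
      then have kpos: "real k powr \<gamma> > 0" by simp
      have "real k powr \<gamma> * real m powr (q * \<gamma>) = (real k * real m powr q) powr \<gamma>"
        by (simp add: powr_mult powr_powr)
      also have "\<dots> \<le> C * (real (k * \<tau>) powr \<gamma> + real m powr p * (real k + real \<tau> powr (- p / 2) * real (k * \<tau>) powr \<gamma>))"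
        using * that \<open>1 \<le> k\<close> by blast
      also have "\<dots> = real k powr \<gamma> * (C * (real \<tau> powr \<gamma> + real m powr p * (real k powr (1 - \<gamma>) + real \<tau> powr (- p / 2) * real \<tau> powr \<gamma>)))"
      proof -
        have "real k = real k powr \<gamma> * real k powr (1 - \<gamma>)"
          using \<open>1 \<le> k\<close> by (simp add: powr_add[symmetric])
        then have "C * (real (k * \<tau>) powr \<gamma> + real m powr p * (real k + real \<tau> powr (- p / 2) * real (k * \<tau>) powr \<gamma>))
          = C * (real (k * \<tau>) powr \<gamma> + real m powr p * (real k powr \<gamma> * real k powr (1 - \<gamma>) + real \<tau> powr (- p / 2) * real (k * \<tau>) powr \<gamma>))"
          by simp
        then show ?thesis by (simp add: powr_mult algebra_simps)
      qed
      finally show "real m powr (q * \<gamma>) \<le> C * (real \<tau> powr \<gamma> + real m powr p * (real k powr (1 - \<gamma>) + real \<tau> powr (- p / 2) * real \<tau> powr \<gamma>))"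
        using kpos by (simp only: mult_le_cancel_left_pos)
    qed
  qed
  have C0: "C \<ge> 0"
  proof (rule ccontr)
    assume "\<not> C \<ge> 0"
    then have "C * (1 + 1) < 0" by simp
    then show False using A1[of 1 1] by simp
  qed
  have A2: "a powr (q * \<gamma>) \<le> C" if "1 \<le> a" for a :: real
  proof (rule LIMSEQ_le_const)
    have "(\<lambda>\<tau>. real \<tau> powr (p / q - p / 2)) \<longlonglongrightarrow> 0"
      using assms by (intro tendsto_neg_powr filterlim_real_sequentially) (auto simp: field_simps)
    then have "(\<lambda>\<tau>. C * (1 + (a + 1) powr p * real \<tau> powr (p / q - p / 2))) \<longlonglongrightarrow> C * (1 + (a + 1) powr p * 0)"
      by (intro tendsto_intros)
    then show "(\<lambda>\<tau>. C * (1 + (a + 1) powr p * real \<tau> powr (p / q - p / 2))) \<longlonglongrightarrow> C" by simp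
    show "\<exists>\<tau>0. \<forall>\<tau>\<ge>\<tau>0. a powr (q * \<gamma>) \<le> C * (1 + (a + 1) powr p * real \<tau> powr (p / q - p / 2))"
    proof (intro exI allI impI)
      fix \<tau> :: nat assume \<tau>: "1 \<le> \<tau>"
      define r where "r = real \<tau> powr (1 / q)"
      have r: "1 \<le> r" unfolding r_def using \<tau> q by (intro ge_one_powr_ge_zero) auto
      \<comment> \<open>Rounding up keeps \<open>a * r \<le> m\<close>, and since
        \<open>r \<ge> 1\<close> the excess is at most \<open>r\<close>.\<close>
      define m where "m = nat \<lceil>a * r\<rceil>"
      have ar: "1 \<le> a * r" using that r mult_mono[of 1 a 1 r] by simp
      have m: "1 \<le> m" "a * r \<le> real m" "real m \<le> (a + 1) * r"
      proof -
        show am: "a * r \<le> real m" unfolding m_def by linarith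
        then show "1 \<le> m" using ar by linarith
        have "real m \<le> a * r + 1" unfolding m_def using ar by linarith
        then show "real m \<le> (a + 1) * r" using r by (simp add: algebra_simps)
      qed
      have rp: "r powr t = real \<tau> powr (t / q)" for t by (simp add: r_def powr_powr)
      have "real \<tau> powr \<gamma> * a powr (q * \<gamma>) = (a * r) powr (q * \<gamma>)"
        using q by (simp add: powr_mult rp)
      also have "\<dots> \<le> real m powr (q * \<gamma>)"
        using m ar q assms by (intro powr_mono2) auto
      also have "\<dots> \<le> C * (real \<tau> powr \<gamma> + real m powr p * (real \<tau> powr (- p / 2) * real \<tau> powr \<gamma>))"
        by (rule A1[OF \<tau> m(1)])
      also have "\<dots> \<le> C * (real \<tau> powr \<gamma> + ((a + 1) * r) powr p * (real \<tau> powr (- p / 2) * real \<tau> powr \<gamma>))"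
        using m p C0 by (intro mult_left_mono add_left_mono mult_right_mono powr_mono2) auto
      also have "\<dots> = real \<tau> powr \<gamma> * (C * (1 + (a + 1) powr p * real \<tau> powr (p / q - p / 2)))"
      proof -
        have "r powr p * real \<tau> powr (- p / 2) = real \<tau> powr (p / q - p / 2)"
          using \<tau> by (simp add: rp powr_add[symmetric])
        then have "((a + 1) * r) powr p * (real \<tau> powr (- p / 2) * real \<tau> powr \<gamma>) = (a + 1) powr p * real \<tau> powr (p / q - p / 2) * real \<tau> powr \<gamma>"
          by (simp add: powr_mult mult.assoc[symmetric])
        then show ?thesis by (simp add: algebra_simps)
      qed
      finally show "a powr (q * \<gamma>) \<le> C * (1 + (a + 1) powr p * real \<tau> powr (p / q - p / 2))"
        using \<tau> by (simp add: mult_le_cancel_left_pos)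
    qed
  qed
  \<comment> \<open>The choice \<open>a = C + 1\<close> contradicts the bound by \<open>C\<close>,
    the exponent \<open>q * \<gamma>\<close> being at least 1.\<close>
  have "(C + 1) \<le> (C + 1) powr (q * \<gamma>)"
  proof -
    have "2 * 1 \<le> q * \<gamma>" using assms by (intro mult_mono) auto
    then show ?thesis using powr_mono[of 1 "q * \<gamma>" "C + 1"] C0 by simp
  qed
  then show False using A2[of "C + 1"] C0 by simp
qed

text \<open>\<open>a * x^2 + b * x\<close> increases on the nonnegative reals and takes the value
  \<open>c\<close> at \<open>B\<close>, so each bound for \<open>B\<close> follows by comparing
  \<open>c\<close> with the value of the quadratic at the other point.\<close>

lemma quadratic_root_bounds:
  fixes p q :: real
  assumes "2 < q" "q < p"
  defines "B \<equiv> (2*q*(p-q) + q^2*(p-1)*(p-2)) / (2*p^2*(q-2)) *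
              (sqrt (1 + 4*p*(p-2)*(q-2) / (p*q - 3*q + 2)^2) - 1)"
  shows "q / p \<le> B" "B \<le> 1 - (p-q)*(q-2) / (2*p^3)"
proof -
  define w where "w = p*q - 3*q + 2"
  define a where "a = p * (q - 2)"
  define b where "b = q * w"
  define c where "c = q\<^sup>2 * (p - 2)"
  define r where "r = sqrt (1 + 4*p*(p-2)*(q-2) / w\<^sup>2)"
  have w: "w > 0"
  proof -
    have "w = (q - 1) * (q - 2) + q * (p - q)" by (simp add: w_def algebra_simps)
    then show ?thesis using assms by (simp add: add_pos_pos)
  qed
  have pos: "a > 0" "b > 0" "c > 0" using assms w by (auto simp: a_def b_def c_def)
  have arg: "0 \<le> 4*p*(p-2)*(q-2) / w\<^sup>2" using assms by (intro divide_nonneg_nonneg mult_nonneg_nonneg) auto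
  have r: "r \<ge> 1" "r\<^sup>2 = 1 + 4*p*(p-2)*(q-2) / w\<^sup>2" using arg by (auto simp: r_def)
  have B: "B = b / (2 * a) * (r - 1)"
  proof -
    \<comment> \<open>This factorisation identifies the prefactor of \<open>B\<close> with
      \<open>b / (2 * a)\<close>, as in the formula for the positive root.\<close>
    have num: "2*q*(p-q) + q^2*(p-1)*(p-2) = p * b"
      by (simp add: b_def w_def algebra_simps power2_eq_square)
    have "(2*q*(p-q) + q^2*(p-1)*(p-2)) / (2*p^2*(q-2)) = b / (2 * a)"
      unfolding num a_def using assms by (simp add: power2_eq_square)
    then show ?thesis by (simp add: B_def r_def w_def)
  qed
  have B0: "B \<ge> 0" using pos r by (simp add: B)
  have root: "a * B\<^sup>2 + b * B = c"
  proof -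
    have "a * B\<^sup>2 + b * B = b\<^sup>2 / (4 * a) * (r\<^sup>2 - 1)"
      using pos by (simp add: B field_simps power2_eq_square)
    also have "r\<^sup>2 - 1 = 4*p*(p-2)*(q-2) / w\<^sup>2" using r by simp
    also have "b\<^sup>2 / (4 * a) * (4*p*(p-2)*(q-2) / w\<^sup>2) = c"
      using w assms by (simp add: b_def a_def c_def field_simps power2_eq_square)
    finally show ?thesis .
  qed
  have mono: "x \<le> y" if "a * x\<^sup>2 + b * x \<le> a * y\<^sup>2 + b * y" "0 \<le> y" for x y
  proof (rule ccontr)
    assume "\<not> x \<le> y"
    then have "y < x" by simp
    then have "b * y < b * x" using pos by simp
    moreover have "a * y\<^sup>2 \<le> a * x\<^sup>2"
      using \<open>y < x\<close> that pos by (intro mult_left_mono power_mono) auto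
    ultimately show False using that by linarith
  qed
  show "q / p \<le> B"
  proof (rule mono[OF _ B0])
    have "c - (a * (q / p)\<^sup>2 + b * (q / p)) = q\<^sup>2 * (p - 2) * (p - q) / p"
      using assms by (simp add: a_def b_def c_def w_def field_simps power2_eq_square)
    moreover have "\<dots> \<ge> 0" using assms by (intro divide_nonneg_nonneg mult_nonneg_nonneg) auto
    ultimately show "a * (q / p)\<^sup>2 + b * (q / p) \<le> a * B\<^sup>2 + b * B" unfolding root by linarith
  qed
  define d where "d = (p-q)*(q-2) / (2*p^3)"
  have d0: "d \<ge> 0" using assms by (simp add: d_def)
  have p3: "p^3 > 0" using assms by simp
  have ab: "2 * a + b \<le> 2 * p^3"
  proof -
    have "p * q\<^sup>2 \<le> p * p\<^sup>2" using assms by (intro mult_left_mono power_mono) auto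
    moreover have "2 * (p * q) \<le> p * (p * p)"
      using assms mult_mono[of 2 p "p * q" "p * p"] by (simp add: mult_left_mono)
    moreover have "2 * a + b = 2 * (p * q) - 4 * p + p * q\<^sup>2 - 3 * q\<^sup>2 + 2 * q"
      by (simp add: a_def b_def w_def algebra_simps power2_eq_square)
    moreover have "2 * q - 4 * p - 3 * q\<^sup>2 \<le> 0" using assms by (smt (verit) zero_le_power2)
    ultimately show ?thesis by (simp add: power2_eq_square power3_eq_cube)
  qed
  \<comment> \<open>At \<open>1 - d\<close> the quadratic equals
    \<open>a + b - d * (2 * a + b) + a * d^2\<close>. To stay above \<open>c\<close> it suffices
    that \<open>d * (2 * a + b)\<close> is at most \<open>a + b - c\<close>, which factors as
    \<open>(p - q) * (q - 2)\<close>.\<close>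
  have "d * (2 * a + b) \<le> d * (2 * p^3)" using ab d0 by (rule mult_left_mono)
  also have "\<dots> = (p - q) * (q - 2)" using assms by (simp add: d_def)
  also have "\<dots> = a + b - c" by (simp add: a_def b_def c_def w_def algebra_simps power2_eq_square)
  finally have "d * (2 * a + b) \<le> a + b - c" .
  moreover have "0 \<le> a * d\<^sup>2" using pos by simp
  ultimately have le: "a * B\<^sup>2 + b * B \<le> a * (1 - d)\<^sup>2 + b * (1 - d)"
    unfolding root by (simp add: power2_eq_square algebra_simps)
  have "d \<le> 1"
  proof -
    have "(p - q) * (q - 2) \<le> p * p" using assms by (intro mult_mono) auto
    also have "\<dots> \<le> 2 * p^3"
      using assms mult_mono[of 1 p "p * p" "p * p"] by (simp add: power3_eq_cube)
    finally show ?thesis using p3 by (simp add: d_def divide_le_eq_1)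
  qed
  then show "B \<le> 1 - (p-q)*(q-2) / (2*p^3)" unfolding d_def[symmetric] by (intro mono[OF le]) simp
qed

section \<open>Snowflakes\<close>

lemma step_grid_distance:
  fixes J :: "'j set" and x y :: "'j \<Rightarrow> int"
  assumes "0 < q" "1 \<le> n" "bij_betw e {..<n} J"
  shows "Lp_dist q (step_fun q n (\<lambda>i. x (e i) / N)) (step_fun q n (\<lambda>i. y (e i) / N))
    = (\<Sum>j\<in>J. \<bar>real_of_int (x j - y j) / N\<bar> powr q) powr (1 / q)"
proof -
  have "(\<Sum>i<n. \<bar>x (e i) / N - y (e i) / N\<bar> powr q) = (\<Sum>i<n. \<bar>real_of_int (x (e i) - y (e i)) / N\<bar> powr q)"
    by (simp add: diff_divide_distrib)
  also have "\<dots> = (\<Sum>j\<in>J. \<bar>real_of_int (x j - y j) / N\<bar> powr q)"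
    by (rule sum.reindex_bij_betw[OF assms(3)])
  finally show ?thesis by (simp add: Lp_dist_step_fun[OF assms(1,2)])
qed

text \<open>The lattice argument is applied to the embedding composed with step functions whose
  values lie on a grid of mesh \<open>1 / N\<close>. A path of \<open>m * N\<close> lattice steps
  has length \<open>m\<close> in each active coordinate.\<close>

lemma snowflake_scale_inequality_discrete:
  fixes p q \<theta> s D :: real and f :: "(real \<Rightarrow> real) \<Rightarrow> real \<Rightarrow> real" and k \<tau> m N :: nat
  assumes p: "2 \<le> p" and q: "0 < q" and \<theta>: "0 < \<theta>" and s: "0 < s" and D: "1 \<le> D"
    and f: "\<And>x. x \<in> Lp_space q \<Longrightarrow> f x \<in> Lp_space p"
    and lower: "\<And>x y. x \<in> Lp_space q \<Longrightarrow> y \<in> Lp_space q \<Longrightarrow> s * Lp_dist q x y powr \<theta> \<le> Lp_dist p (f x) (f y)"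
    and upper: "\<And>x y. x \<in> Lp_space q \<Longrightarrow> y \<in> Lp_space q \<Longrightarrow> Lp_dist p (f x) (f y) \<le> D * s * Lp_dist q x y powr \<theta>"
    and pos: "1 \<le> k" "1 \<le> \<tau>" "1 \<le> N"
  defines "\<gamma> \<equiv> \<theta> * p / q" and "K \<equiv> (D * s) powr p"
    and "R \<equiv> exp (rosenthal_const p) * rosenthal_const p"
  shows "s powr p * (real k * real m powr q) powr \<gamma> \<le> 3 powr (p - 1) * (2 * K * real (k * \<tau>) powr \<gamma>
    + 2 powr (p - 1) * (2 * (R * K * (8 * real m) powr p * (real k + real \<tau> powr (- p / 2) * real (k * \<tau>) powr \<gamma>))
      + (real m * real k) powr p * (2 powr (p - 1) * K * (8 powr p * (real (k * \<tau>) / real N powr q) powr \<gamma> + (3 / real N ^ 2) powr p))))"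
proof -
  define J where "J = {..<k} \<times> {..<\<tau>}"
  define n where "n = k * \<tau>"
  have J: "finite J" "card J = n" by (auto simp: J_def n_def)
  have n: "1 \<le> n" using pos by (simp add: n_def)
  obtain e where e: "bij_betw e {..<n} J"
    using ex_bij_betw_nat_finite[OF J(1)] J(2) by (auto simp: atLeast0LessThan)
  define M where "M = lebesgue_on {0..1::real}"
  define g where "g = (\<lambda>x. step_fun q n (\<lambda>i. real_of_int (x (e i)) / N))"
  define F where "F = (\<lambda>x. f (g x))"
  define d where "d = (\<lambda>x y. \<Sum>j\<in>J. \<bar>real_of_int (x j - y j) / N\<bar> powr q)"
  have d0: "0 \<le> d x y" for x y by (auto simp: d_def intro!: sum_nonneg)
  have g: "g x \<in> Lp_space q" for x
    unfolding g_def Lp_space_eq by (rule step_fun_moment(1)[OF q n])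
  have dist: "Lp_dist q (g x) (g y) powr \<theta> = d x y powr (\<theta> / q)" for x y
    unfolding g_def step_grid_distance[OF q n e] d_def by (simp add: powr_powr)
  have mom: "moment M p (\<lambda>\<omega>. F x \<omega> - F y \<omega>) = Lp_dist p (F x) (F y) powr p" for x y
    unfolding M_def using p by (intro moment_eq_Lp_dist) simp
  have up: "moment M p (\<lambda>\<omega>. F x \<omega> - F y \<omega>) \<le> K * d x y powr \<gamma>" for x y
  proof -
    have "Lp_dist p (F x) (F y) powr p \<le> (D * s * d x y powr (\<theta> / q)) powr p"
      using upper[OF g[of x] g[of y]] p unfolding dist F_def
      by (intro powr_mono2) (auto simp: Lp_dist_def Lp_norm_def)
    then show ?thesis using D s by (simp add: mom K_def \<gamma>_def powr_mult powr_powr)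
  qed
  have low: "s powr p * d x y powr \<gamma> \<le> moment M p (\<lambda>\<omega>. F x \<omega> - F y \<omega>)" for x y
  proof -
    have "(s * d x y powr (\<theta> / q)) powr p \<le> Lp_dist p (F x) (F y) powr p"
      using lower[OF g[of x] g[of y]] p s unfolding dist F_def by (intro powr_mono2) auto
    then show ?thesis using s by (simp add: mom \<gamma>_def powr_mult powr_powr)
  qed
  obtain \<rho> \<sigma> :: "int \<Rightarrow> real" and \<beta> where w:
    "\<And>i. 0 \<le> \<rho> i" "(\<Sum>i\<in>{-int N..int N}. \<rho> i) = 1"
    "(\<Sum>i\<in>{-int N..int N}. \<rho> i * \<sigma> i) = 0"
    "(\<Sum>i\<in>{-int N..int N}. \<rho> i * (\<sigma> i)\<^sup>2) \<le> 54 / real N ^ 2"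
    "0 \<le> \<beta>" "\<beta> \<le> 3 / real N ^ 3"
    "\<And>\<psi>. (\<Sum>i\<in>{-int N..int N}. \<rho> i * \<psi> (i + 1)) - (\<Sum>i\<in>{-int N..int N}. \<rho> i * \<psi> i)
        = (\<Sum>i\<in>{-int N..int N}. \<rho> i * \<sigma> i * \<psi> i) + \<beta> * (\<psi> (int N) - \<psi> 0)"
    by (rule quadratic_weights[OF pos(3)]) (rule that)
  interpret block_lattice_map M p q \<gamma> K N k \<tau> F \<rho> \<sigma> \<beta>
  proof unfold_locales
    show "F x \<in> Lp_fun M p" for x
      using f[OF g[of x]] by (simp add: F_def M_def Lp_space_eq)
    show "moment M p (\<lambda>\<omega>. F x \<omega> - F y \<omega>)
        \<le> K * (\<Sum>j\<in>{..<k} \<times> {..<\<tau>}. \<bar>real_of_int (x j - y j) / N\<bar> powr q) powr \<gamma>" for x y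
      using up[of x y] by (simp only: d_def J_def)
    show "F (restrict x ({..<k} \<times> {..<\<tau>})) = F x" for x
    proof -
      have "restrict x J (e i) = x (e i)" if "i < n" for i
        using bij_betw_apply[OF e, of i] that by simp
      then show ?thesis unfolding F_def g_def step_fun_def J_def[symmetric] by simp
    qed
  qed (use p q \<theta> pos w in \<open>auto simp: \<gamma>_def K_def\<close>)
  \<comment> \<open>The displacement has exactly one nonzero coordinate per block, of size
    \<open>m\<close>, so the q-th power of its norm is \<open>k * m powr q\<close>.\<close>
  have low': "s powr p * (real k * real m powr q) powr \<gamma>
      \<le> moment M p (\<lambda>\<omega>. F (\<lambda>i. x i + int (m * N) * dir \<alpha> i) \<omega> - F x \<omega>)" if \<alpha>: "\<alpha> \<in> dirs" for \<alpha> x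
  proof -
    have "d (\<lambda>i. x i + int (m * N) * dir \<alpha> i) x = (\<Sum>b<k. \<Sum>i<\<tau>. \<bar>real_of_int (int (m * N) * dir \<alpha> (b, i)) / N\<bar> powr q)"
    proof -
      have "(\<Sum>j\<in>J. h j) = (\<Sum>b<k. \<Sum>i<\<tau>. h (b, i))" for h :: "nat \<times> nat \<Rightarrow> real"
        by (simp add: J_def sum.cartesian_product)
      then show ?thesis by (simp only: d_def add_diff_cancel_left')
    qed
    also have "\<dots> = (\<Sum>b<k. \<Sum>i<\<tau>. if i = fst (\<alpha> b) then real m powr q else 0)"
    proof (intro sum.cong refl)
      fix b i assume "b \<in> {..<k}"
      then have b: "b < k" by simp
      have "\<bar>real_of_int (int (m * N) * dir \<alpha> (b, i)) / N\<bar> = (if i = fst (\<alpha> b) then real m else 0)"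
        using dirs_D(2)[OF \<alpha> b] pos b by (auto simp: partial_dir_def)
      then show "\<bar>real_of_int (int (m * N) * dir \<alpha> (b, i)) / N\<bar> powr q = (if i = fst (\<alpha> b) then real m powr q else 0)"
        using q by simp
    qed
    also have "\<dots> = real k * real m powr q"
      using dirs_D(1)[OF \<alpha>] by simp
    finally show ?thesis using low[of "\<lambda>i. x i + int (m * N) * dir \<alpha> i" x] by simp
  qed
  have Npos: "real N > 0" using pos by simp
  \<comment> \<open>The \<open>m * N\<close> steps cancel the \<open>1 / N\<close> of the
    derivative, so the main term is independent of the mesh.\<close>
  have U': "real (m * N) powr p * U = R * K * (8 * real m) powr p * (real k + real \<tau> powr (- p / 2) * real (k * \<tau>) powr \<gamma>)"
  proof -
    have "real (m * N) * (8 / real N) = 8 * real m" using Npos by simp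
    then have "real (m * N) powr p * (8 / real N) powr p = (8 * real m) powr p"
      by (simp only: powr_mult[symmetric])
    then show ?thesis by (simp add: U_def rc_def R_def mult_ac)
  qed
  \<comment> \<open>Here a negative power of \<open>N\<close> survives: through the oscillation over
    one lattice step in the first term, and as \<open>N^-2\<close> inside the power in the
    second.\<close>
  have \<delta>': "(real (m * N) * real k) powr p * \<delta>
      = (real m * real k) powr p * (2 powr (p - 1) * K * (8 powr p * (real (k * \<tau>) / real N powr q) powr \<gamma> + (3 / real N ^ 2) powr p))"
  proof -
    have 1: "(real (m * N) * real k) powr p * (8 / real N) powr p = (real m * real k) powr p * 8 powr p"
    proof -
      have "(real (m * N) * real k) * (8 / real N) = (real m * real k) * 8" using Npos by simp
      then show ?thesis by (simp only: powr_mult[symmetric])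
    qed
    have 2: "(real (m * N) * real k) powr p * (3 / real N ^ 3) powr p = (real m * real k) powr p * (3 / real N ^ 2) powr p"
    proof -
      have "(real (m * N) * real k) * (3 / real N ^ 3) = (real m * real k) * (3 / real N ^ 2)"
        using Npos by (simp add: power2_eq_square power3_eq_cube)
      then show ?thesis by (simp only: powr_mult[symmetric])
    qed
    have "(real (m * N) * real k) powr p * \<delta> = 2 powr (p - 1) * K *
        (((real (m * N) * real k) powr p * (8 / real N) powr p) * (real (k * \<tau>) / real N powr q) powr \<gamma>
          + (real (m * N) * real k) powr p * (3 / real N ^ 3) powr p)"
      unfolding \<delta>_def \<epsilon>_def card_cartesian_product card_lessThan by (simp only: distrib_left mult_ac)
    then show ?thesis unfolding 1 2 by (simp add: algebra_simps)
  qed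
  show ?thesis
    using long_step_le[of "s powr p * (real k * real m powr q) powr \<gamma>" "m * N", OF low']
    unfolding \<delta>' mult.assoc[of 2 "real (m * N) powr p" U] U' .
qed

text \<open>With \<open>k\<close>, \<open>\<tau>\<close>, \<open>m\<close> fixed, letting
  \<open>N\<close> tend to infinity removes both discretisation errors. The remaining constants
  depend only on \<open>p\<close>, \<open>s\<close> and \<open>D\<close>.\<close>

lemma snowflake_scale_inequality:
  fixes p q \<theta> s D :: real and f :: "(real \<Rightarrow> real) \<Rightarrow> real \<Rightarrow> real"
  assumes p: "2 \<le> p" and q: "0 < q" and \<theta>: "0 < \<theta>" and s: "0 < s" and D: "1 \<le> D"
    and f: "\<And>x. x \<in> Lp_space q \<Longrightarrow> f x \<in> Lp_space p"
    and lower: "\<And>x y. x \<in> Lp_space q \<Longrightarrow> y \<in> Lp_space q \<Longrightarrow> s * Lp_dist q x y powr \<theta> \<le> Lp_dist p (f x) (f y)"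
    and upper: "\<And>x y. x \<in> Lp_space q \<Longrightarrow> y \<in> Lp_space q \<Longrightarrow> Lp_dist p (f x) (f y) \<le> D * s * Lp_dist q x y powr \<theta>"
  obtains C where "\<And>k \<tau> m :: nat. 1 \<le> k \<Longrightarrow> 1 \<le> \<tau> \<Longrightarrow> (real k * real m powr q) powr (\<theta> * p / q)
    \<le> C * (real (k * \<tau>) powr (\<theta> * p / q)
        + real m powr p * (real k + real \<tau> powr (- p / 2) * real (k * \<tau>) powr (\<theta> * p / q)))"
proof -
  define \<gamma> where "\<gamma> = \<theta> * p / q"
  define K where "K = (D * s) powr p"
  define R where "R = exp (rosenthal_const p) * rosenthal_const p"
  define c1 where "c1 = 3 powr (p - 1) * (2 * K)"
  define c2 where "c2 = 3 powr (p - 1) * (2 powr (p - 1) * (2 * (R * K * 8 powr p)))"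
  have R: "R > 0" by (simp add: R_def rosenthal_const_pos)
  have c: "c1 \<ge> 0" "c2 \<ge> 0" using less_imp_le[OF R] by (auto simp: c1_def c2_def K_def)
  have \<gamma>: "\<gamma> > 0" using p q \<theta> by (simp add: \<gamma>_def)
  have main: "(real k * real m powr q) powr \<gamma>
      \<le> (c1 + c2) / s powr p * (real (k * \<tau>) powr \<gamma> + real m powr p * (real k + real \<tau> powr (- p / 2) * real (k * \<tau>) powr \<gamma>))"
    if kt: "1 \<le> k" "1 \<le> \<tau>" for k \<tau> m :: nat
  proof -
    define a where "a = real (k * \<tau>) powr \<gamma>"
    define b where "b = real k + real \<tau> powr (- p / 2) * a"
    have ab: "a \<ge> 0" "b \<ge> 0" by (auto simp: a_def b_def)
    have "s powr p * (real k * real m powr q) powr \<gamma> \<le> 3 powr (p - 1) * (2 * K * a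
      + 2 powr (p - 1) * (2 * (R * K * (8 * real m) powr p * b)
        + (real m * real k) powr p * (2 powr (p - 1) * K * (8 powr p * 0 + 0))))"
    proof (rule LIMSEQ_le_const)
      have inv: "(\<lambda>N. c / real N powr e) \<longlonglongrightarrow> 0" if "e > 0" for c e :: real
      proof -
        have "(\<lambda>N. c * real N powr (- e)) \<longlonglongrightarrow> c * 0"
          using that by (intro tendsto_intros tendsto_neg_powr filterlim_real_sequentially) auto
        then show ?thesis by (simp add: powr_minus_divide)
      qed
      have 1: "(\<lambda>N. (real (k * \<tau>) / real N powr q) powr \<gamma>) \<longlonglongrightarrow> 0"
        by (rule tendsto_zero_powrI[OF inv[OF q] tendsto_const _ \<gamma>]) auto
      have "(\<lambda>N. 3 / real N ^ 2) \<longlonglongrightarrow> 0" using inv[of 2 3] by simp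
      then have 2: "(\<lambda>N. (3 / real N ^ 2) powr p) \<longlonglongrightarrow> 0"
        by (rule tendsto_zero_powrI[OF _ tendsto_const]) (use p in auto)
      show "(\<lambda>N. 3 powr (p - 1) * (2 * K * a
        + 2 powr (p - 1) * (2 * (R * K * (8 * real m) powr p * b)
          + (real m * real k) powr p * (2 powr (p - 1) * K * (8 powr p * (real (k * \<tau>) / real N powr q) powr \<gamma> + (3 / real N ^ 2) powr p)))))
        \<longlonglongrightarrow> 3 powr (p - 1) * (2 * K * a
        + 2 powr (p - 1) * (2 * (R * K * (8 * real m) powr p * b)
          + (real m * real k) powr p * (2 powr (p - 1) * K * (8 powr p * 0 + 0))))"
        by (intro tendsto_add tendsto_mult tendsto_const 1 2)
      show "\<exists>N0. \<forall>N\<ge>N0. s powr p * (real k * real m powr q) powr \<gamma> \<le> 3 powr (p - 1) * (2 * K * a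
        + 2 powr (p - 1) * (2 * (R * K * (8 * real m) powr p * b)
          + (real m * real k) powr p * (2 powr (p - 1) * K * (8 powr p * (real (k * \<tau>) / real N powr q) powr \<gamma> + (3 / real N ^ 2) powr p))))"
        unfolding a_def b_def K_def R_def \<gamma>_def
        using snowflake_scale_inequality_discrete[OF p q \<theta> s D f lower upper kt] by blast
    qed
    also have "\<dots> = c1 * a + c2 * (real m powr p * b)"
      by (simp add: c1_def c2_def powr_mult algebra_simps)
    also have "\<dots> \<le> (c1 + c2) * (a + real m powr p * b)"
      using c ab by (simp add: algebra_simps)
    finally have "(real k * real m powr q) powr \<gamma> \<le> (c1 + c2) * (a + real m powr p * b) / s powr p"
      using s by (simp add: pos_le_divide_eq mult.commute)
    then show ?thesis by (simp add: a_def b_def)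
  qed
  show ?thesis using that main unfolding \<gamma>_def by blast
qed

text \<open>An exponent above \<open>q / p\<close> means \<open>\<theta> * p / q > 1\<close>, and
  then the scale inequality cannot hold for all \<open>k\<close>, \<open>\<tau>\<close>,
  \<open>m\<close>.\<close>

lemma snowflake_exponent_le:
  fixes p q \<theta> :: real
  assumes "2 < q" "q < p" "0 < \<theta>"
    and "bilip_embeds (Lp_space q) (\<lambda>x y. (Lp_dist q x y) powr \<theta>) (Lp_space p) (Lp_dist p)"
  shows "\<theta> \<le> q / p"
proof (rule ccontr)
  assume "\<not> \<theta> \<le> q / p"
  then have \<gamma>: "1 < \<theta> * p / q" using assms by (simp add: field_simps)
  obtain s D f where "s > 0" "D \<ge> 1" and f: "\<And>x. x \<in> Lp_space q \<Longrightarrow> f x \<in> Lp_space p"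
    "\<And>x y. x \<in> Lp_space q \<Longrightarrow> y \<in> Lp_space q \<Longrightarrow> s * Lp_dist q x y powr \<theta> \<le> Lp_dist p (f x) (f y)"
    "\<And>x y. x \<in> Lp_space q \<Longrightarrow> y \<in> Lp_space q \<Longrightarrow> Lp_dist p (f x) (f y) \<le> D * s * Lp_dist q x y powr \<theta>"
    using assms(4) unfolding bilip_embeds_def by blast
  have "2 \<le> p" "0 < q" using assms by auto
  from snowflake_scale_inequality[OF this assms(3) \<open>s > 0\<close> \<open>D \<ge> 1\<close> f] obtain C where
    "\<And>k \<tau> m :: nat. 1 \<le> k \<Longrightarrow> 1 \<le> \<tau> \<Longrightarrow> (real k * real m powr q) powr (\<theta> * p / q)
      \<le> C * (real (k * \<tau>) powr (\<theta> * p / q)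
        + real m powr p * (real k + real \<tau> powr (- p / 2) * real (k * \<tau>) powr (\<theta> * p / q)))"
    by blast
  then show False
    using scale_inequality_exponent[of p q "\<theta> * p / q" C] assms \<gamma> by auto
qed

theorem mainTheorem4:
  fixes p q \<theta> :: real
  assumes "2 < q" and "q < p" and "0 < \<theta>" and "\<theta> < 1"
    and "bilip_embeds (Lp_space q) (\<lambda>x y. (Lp_dist q x y) powr \<theta>) (Lp_space p) (Lp_dist p)"
  shows "\<theta> \<le> (2*q*(p-q) + q^2*(p-1)*(p-2)) / (2*p^2*(q-2)) *
              (sqrt (1 + 4*p*(p-2)*(q-2) / (p*q - 3*q + 2)^2) - 1)
       \<and> (2*q*(p-q) + q^2*(p-1)*(p-2)) / (2*p^2*(q-2)) *
              (sqrt (1 + 4*p*(p-2)*(q-2) / (p*q - 3*q + 2)^2) - 1)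
         \<le> 1 - (p-q)*(q-2) / (2*p^3)"
  using order_trans[OF snowflake_exponent_le[OF assms(1,2,3,5)] quadratic_root_bounds(1)[OF assms(1,2)]]
    quadratic_root_bounds(2)[OF assms(1,2)]
  by (rule conjI)

end
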